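(* Consider a problem of the form $\min_{x\in\mathbb{R}^n}\{f(x)\mid Mx\in V\}$, where $f:\mathbb{R}^n\to\mathbb{R}\cup\{+\infty\}$ is closed proper convex, $M$ is an $m\times n$ real matrix, and $V$ is a linear subspace of $\mathbb{R}^m$; its dual problem is $\min_{p\in V^\perp}f^*(-M^\top p)$. Let $W$ be a symmetric positive definite $m\times m$ matrix, let $\{\tau_k\}_{k=0}^\infty$ be a sequence of nonnegative reals with $\sum_{k=0}^\infty\sqrt{\tau_k}<\infty$, and let $\{\nu_k\}_{k=0}^\infty\subset\mathbb{R}$ satisfy $\inf_k\nu_k>0$ and $\sup_k\nu_k<2$. For a constant scalar $c>0$ and arbitrary initial $z^0\in V$ and $p^0\in V^\perp$, suppose that the sequences $\{z^k\}_{k=0}^\infty,\{v^k\}_{k=1}^\infty\subset V$, $\{p^k\}_{k=0}^\infty\subset V^\perp$, and $\{x^k\}_{k=1}^\infty\subset\mathbb{R}^n$ satisfy the following for all $k\ge0$: $$x^{k+1}\in\tau_k\text{-}\!\operatorname*{arg\,min}_{x\in\mathbb{R}^n}\Big\{f(x)+\langle p^k,Mx\rangle+\frac c2\|Mx-z^k\|_W^2\Big\},$$ $$v^{k+1}=W\text{-}\mathrm{proj}_V(Mx^{k+1}),$$ $$z^{k+1}=\nu_kv^{k+1}+(1-\nu_k)z^k,$$ $$p^{k+1}=p^k+\nu_kcW(Mx^{k+1}-v^{k+1}),$$ where the exact minimum in the first minimization is assumed to be attained for every $k$. If strong duality holds, then $\{p^k\}$ converges to a solution $p^*\in V^\perp$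 of the dual problem, while $\{z^k\}$, $\{v^k\}$, and $\{Mx^k\}$ converge to some $z^*\in V$ such that $-z^*\in\partial\big(f^*\circ(-M^\top)\big)(p^* )$. If the regularity condition $\operatorname{ri}\operatorname{im}\partial f\cap\operatorname{im}M^\top\ne\emptyset$ is also true, then $z^*=Mx^*$, where $x^*$ is some solution of the primal problem $\min_{x\in\mathbb{R}^n}\{f(x)\mid Mx\in V\}$, and in this case all limit points of $\{x^k\}$ are optimal primal solutions. If the dual problem has no solution but there exists some $\bar p\in\mathbb{R}^m$ at which the dual objective is finite, then at least one of the sequences $\{p^k\}$ or $\{z^k\}$ must be unbounded.
   Context: $\|u\|_W=\sqrt{u^\top Wu}$ and $W\text{-}\mathrm{proj}_V(z)=\operatorname*{arg\,min}_{v\in V}\|v-z\|_W$. $V^\perp$ is the orthogonal complement of $V$. $f^*$ is the convex conjugate; $f^*\circ(-M^\top)$ is $p\mapsto f^*(-M^\top p)$; $\partial$ is the convex subdifferential; $\operatorname{im}\partial f=\bigcup_x\partial f(x)$; $\operatorname{im}M^\top$ is the range of $M^\top$; $\operatorname{ri}$ is the relative interior. For $\delta\ge0$, a set $S$ and $h:S\to\mathbb{R}\cup\{\pm\infty\}$, $\ \delta\text{-}\!\operatorname*{arg\,min}_{x\in S}\{h(x)\}=\{x\in S\mid h(x)\le(\inf_{y\in S}h(y))+\delta\}$. The problem is $\min_x\{f(x)+g(Mx)\}$ with $g$ the indicator function of $V$ ($0$ on $V$, $+\infty$ elsewhere), for which $g^*$ is the indicator function of $V^\perp$; the dual objective is $p\mapsto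 f^*(-M^\top p)+g^*(p)$, i.e. $f^*(-M^\top p)$ for $p\in V^\perp$ and $+\infty$ otherwise. "Strong duality holds" means that there exist $x^*\in\mathbb{R}^n$ with $Mx^*\in V$ and $p^*\in V^\perp$ such that $f(x^* )+f^*(-M^\top p^* )=0$. *)

theory Defs
  imports "HOL-Analysis.Analysis"
begin

definition ereal_epigraph :: "('a \<Rightarrow> ereal) \<Rightarrow> ('a \<times> real) set"
  where "ereal_epigraph f = {(x, t). f x \<le> ereal t}"

text \<open>Closedness is that of the epigraph, i.e. lower semicontinuity.\<close>

definition closed_proper_convex :: "('a::real_normed_vector \<Rightarrow> ereal) \<Rightarrow> bool"
  where "closed_proper_convex f \<longleftrightarrow>
    closed (ereal_epigraph f) \<and> convex (ereal_epigraph f) \<and>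
    (\<forall>x. f x \<noteq> - \<infinity>) \<and> (\<exists>x. f x \<noteq> \<infinity>)"

definition convex_conjugate :: "('a::real_inner \<Rightarrow> ereal) \<Rightarrow> 'a \<Rightarrow> ereal"
  where "convex_conjugate f y = (SUP x. ereal (x \<bullet> y) - f x)"

text \<open>For a proper function this set is empty wherever the function is \<open>\<infinity>\<close>.\<close>

definition subdifferential :: "('a::real_inner \<Rightarrow> ereal) \<Rightarrow> 'a \<Rightarrow> 'a set"
  where "subdifferential f x = {s. \<forall>y. f x + ereal (s \<bullet> (y - x)) \<le> f y}"

definition convex_indicator :: "'a set \<Rightarrow> 'a \<Rightarrow> ereal"
  where "convex_indicator S x = (if x \<in> S then 0 else \<infinity>)"

definition symmetric_positive_definite :: "real ^ 'm ^ 'm \<Rightarrow> bool"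
  where "symmetric_positive_definite W \<longleftrightarrow>
    transpose W = W \<and> (\<forall>u. u \<noteq> 0 \<longrightarrow> u \<bullet> (W *v u) > 0)"

definition weighted_norm :: "real ^ 'm ^ 'm \<Rightarrow> real ^ 'm \<Rightarrow> real"
  where "weighted_norm W u = sqrt (u \<bullet> (W *v u))"

text \<open>For symmetric positive definite \<open>W\<close> and a subspace \<open>V\<close> the minimizer exists and is
  unique, so the choice made by \<^const>\<open>arg_min_on\<close> is immaterial.\<close>

definition weighted_proj :: "real ^ 'm ^ 'm \<Rightarrow> (real ^ 'm) set \<Rightarrow> real ^ 'm \<Rightarrow> real ^ 'm"
  where "weighted_proj W V z = arg_min_on (\<lambda>v. weighted_norm W (v - z)) V"

definition approx_arg_min :: "real \<Rightarrow> 'a set \<Rightarrow> ('a \<Rightarrow> ereal) \<Rightarrow> 'a set"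
  where "approx_arg_min \<delta> S h = {x \<in> S. h x \<le> (INF y\<in>S. h y) + ereal \<delta>}"

definition subproblem_objective ::
  "(real ^ 'n \<Rightarrow> ereal) \<Rightarrow> real ^ 'n ^ 'm \<Rightarrow> real ^ 'm ^ 'm \<Rightarrow> real \<Rightarrow>
    real ^ 'm \<Rightarrow> real ^ 'm \<Rightarrow> real ^ 'n \<Rightarrow> ereal"
  where "subproblem_objective f M W c p z x =
    f x + ereal (p \<bullet> (M *v x)) + ereal (c / 2 * (weighted_norm W (M *v x - z))\<^sup>2)"

definition primal_solution ::
  "(real ^ 'n \<Rightarrow> ereal) \<Rightarrow> real ^ 'n ^ 'm \<Rightarrow> (real ^ 'm) set \<Rightarrow> real ^ 'n \<Rightarrow> bool"
  where "primal_solution f M V x \<longleftrightarrow> is_arg_min f (\<lambda>x. M *v x \<in> V) x"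

definition conjugate_comp ::
  "(real ^ 'n \<Rightarrow> ereal) \<Rightarrow> real ^ 'n ^ 'm \<Rightarrow> real ^ 'm \<Rightarrow> ereal"
  where "conjugate_comp f M p = convex_conjugate f (- (transpose M *v p))"

definition dual_solution ::
  "(real ^ 'n \<Rightarrow> ereal) \<Rightarrow> real ^ 'n ^ 'm \<Rightarrow> (real ^ 'm) set \<Rightarrow> real ^ 'm \<Rightarrow> bool"
  where "dual_solution f M V p \<longleftrightarrow> is_arg_min (conjugate_comp f M) (\<lambda>p. p \<in> V\<^sup>\<bottom>) p"

text \<open>The Fenchel dual objective for \<open>f(x) + g(M x)\<close> with \<open>g\<close> the indicator function of \<open>V\<close>;
  the second summand is the indicator function of \<open>V\<^sup>\<bottom>\<close>.\<close>

definition dual_objective ::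
  "(real ^ 'n \<Rightarrow> ereal) \<Rightarrow> real ^ 'n ^ 'm \<Rightarrow> (real ^ 'm) set \<Rightarrow> real ^ 'm \<Rightarrow> ereal"
  where "dual_objective f M V p =
    conjugate_comp f M p + convex_conjugate (convex_indicator V) p"

definition strong_duality ::
  "(real ^ 'n \<Rightarrow> ereal) \<Rightarrow> real ^ 'n ^ 'm \<Rightarrow> (real ^ 'm) set \<Rightarrow> bool"
  where "strong_duality f M V \<longleftrightarrow>
    (\<exists>x p. M *v x \<in> V \<and> p \<in> V\<^sup>\<bottom> \<and> f x + conjugate_comp f M p = 0)"

end

theory Submission
  imports Defs
begin

text \<open>
  Put \<open>A = c W\<close>, \<open>h = f\<^sup>* \<circ> (- M\<^sup>T)\<close>, \<open>u\<^sub>k = A\<^sup>-\<^sup>1 p\<^sub>k\<close> and \<open>s\<^sub>k = z\<^sub>k + u\<^sub>k\<close>, an orthogonal sum for the form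
  \<open>(a, b) \<mapsto> a \<bullet> A b\<close>. If \<open>y\<^sub>k\<close> is the image under \<open>M\<close> of an exact minimizer of the \<open>k\<close>-th subproblem and
  \<open>d\<^sub>k = y\<^sub>k - z\<^sub>k\<close>, optimality says \<open>- (z\<^sub>k + d\<^sub>k) \<in> \<partial>h (A (u\<^sub>k + d\<^sub>k))\<close>, and the iteration becomes
  \<open>s\<^sub>k\<^sub>+\<^sub>1 = s\<^sub>k + \<nu>\<^sub>k d\<^sub>k + e\<^sub>k\<close>; strong convexity of the subproblem in \<open>M x\<close> makes \<open>e\<^sub>k\<close> of order
  \<open>\<surd>\<tau>\<^sub>k\<close>, hence summable. Monotonicity of \<open>\<partial>h\<close> shows that \<open>s\<^sub>k\<close> is quasi-Fejer
  monotone with respect to all \<open>z + u\<close> with \<open>z \<in> V\<close>, \<open>A u \<in> V\<^sup>\<bottom>\<close> and \<open>- z \<in> \<partial>h (A u)\<close>, which gives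
  convergence as soon as such a pair exists.

  Without a dual solution, suppose that \<open>s\<^sub>k\<close> is bounded. Minimizing \<open>h\<close> plus a quadratic yields, for every
  \<open>\<epsilon> > 0\<close>, a point \<open>t = z + u\<close> with \<open>- (z + \<epsilon> t) \<in> \<partial>h (A (u + \<epsilon> t))\<close>. If \<open>t\<close> is large compared
  with the iterates, the Fejer estimate relative to \<open>t\<close> decreases by a fixed amount at each step, which is
  impossible. So these points stay bounded, and a cluster point as \<open>\<epsilon> \<rightarrow> 0\<close> is a dual solution.

  The regularity condition enters through the chain rule for \<open>\<partial>h\<close>, which writes \<open>z\<^sup>*\<close> as \<open>M x\<^sup>*\<close>.
\<close>

section \<open>Positive definite forms\<close>

locale spd_form =
  fixes A :: "'a::euclidean_space \<Rightarrow> 'a"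
  assumes lin: "linear A"
    and sym: "\<And>a b. A a \<bullet> b = a \<bullet> A b"
    and pos: "\<And>a. a \<noteq> 0 \<Longrightarrow> 0 < a \<bullet> A a"
begin

definition form :: "'a \<Rightarrow> 'a \<Rightarrow> real" where "form a b = a \<bullet> A b"

definition nrm :: "'a \<Rightarrow> real" where "nrm a = sqrt (form a a)"

lemma form_add_left: "form (a + b) w = form a w + form b w"
  by (simp add: form_def inner_add_left)

lemma form_add_right: "form w (a + b) = form w a + form w b"
  by (simp add: form_def inner_add_right linear_add[OF lin])

lemma form_diff_left: "form (a - b) w = form a w - form b w"
  by (simp add: form_def inner_diff_left)

lemma form_diff_right: "form w (a - b) = form w a - form w b"
  by (simp add: form_def inner_diff_right linear_diff[OF lin])

lemma form_scaleR_left: "form (t *\<^sub>R a) b = t * form a b"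
  by (simp add: form_def)

lemma form_scaleR_right: "form a (t *\<^sub>R b) = t * form a b"
  by (simp add: form_def linear_scale[OF lin])

lemmas form_bilinear = form_add_left form_add_right form_diff_left form_diff_right
  form_scaleR_left form_scaleR_right

lemma form_commute: "form a b = form b a"
  by (metis form_def inner_commute sym)

lemma form_nonneg: "0 \<le> form a a"
  by (cases "a = 0") (auto simp: form_def dest: pos less_imp_le)

lemma form_quadratic:
  "form (a + t *\<^sub>R b) (a + t *\<^sub>R b) = form a a + 2 * t * form a b + t\<^sup>2 * form b b"
  unfolding form_bilinear form_commute[of b a] by (simp add: algebra_simps power2_eq_square)

lemma nrm_nonneg: "0 \<le> nrm a"
  by (simp add: nrm_def form_nonneg)

lemma nrm_sq: "(nrm a)\<^sup>2 = form a a"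
  by (simp add: nrm_def form_nonneg)

lemma nrm_zero: "nrm 0 = 0"
  by (simp add: nrm_def form_def)

lemma nrm_pos: "a \<noteq> 0 \<Longrightarrow> 0 < nrm a"
  using pos[of a] by (simp add: nrm_def form_def)

lemma nrm_scaleR: "nrm (t *\<^sub>R a) = \<bar>t\<bar> * nrm a"
  by (simp add: nrm_def form_scaleR_left form_scaleR_right real_sqrt_mult)

text \<open>Cauchy-Schwarz: the vector \<open>F *\<^sub>R a - G *\<^sub>R b\<close> is
  \<open>F\<close> times the part of \<open>a\<close> orthogonal to \<open>b\<close>, and
  nonnegativity of the form there is the claim.\<close>

lemma form_le_nrm: "form a b \<le> nrm a * nrm b"
proof (cases "b = 0")
  case True
  then show ?thesis by (simp add: form_def nrm_def linear_0[OF lin])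
next
  case False
  define F where "F = form b b"
  define G where "G = form a b"
  have F: "F > 0" using pos[OF False] by (simp add: form_def F_def)
  have "0 \<le> form (F *\<^sub>R a - G *\<^sub>R b) (F *\<^sub>R a - G *\<^sub>R b)" by (rule form_nonneg)
  also have "\<dots> = F * (F * form a a - G\<^sup>2)"
    by (simp add: form_bilinear form_commute[of b a] F_def[symmetric] G_def[symmetric]
        algebra_simps power2_eq_square)
  finally have "G\<^sup>2 \<le> F * form a a"
    using F by (simp add: zero_le_mult_iff)
  also have "\<dots> = (nrm a * nrm b)\<^sup>2"
    by (simp add: power_mult_distrib nrm_sq F_def)
  finally have "G \<le> nrm a * nrm b"
    by (rule power2_le_imp_le) (simp add: nrm_nonneg)
  then show ?thesis by (simp add: G_def)
qed

lemma nrm_triangle: "nrm (a + b) \<le> nrm a + nrm b"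
proof (rule power2_le_imp_le)
  show "(nrm (a + b))\<^sup>2 \<le> (nrm a + nrm b)\<^sup>2"
    using form_le_nrm[of a b] form_commute[of a b]
    by (simp add: nrm_sq power2_sum form_bilinear)
qed (simp add: nrm_nonneg)

lemma nrm_diff_triangle: "nrm (a - b) \<le> nrm a + nrm b"
  using nrm_triangle[of a "- b"] nrm_scaleR[of "-1" b] by simp

lemma continuous_on_nrm: "continuous_on S nrm"
proof -
  have "continuous_on S A"
    by (intro linear_continuous_on linear_conv_bounded_linear[THEN iffD1] lin)
  then show ?thesis unfolding nrm_def form_def by (intro continuous_intros)
qed

text \<open>On the compact unit sphere \<open>nrm\<close> attains a positive minimum, and
  homogeneity does the rest. This carries bounds and limits from \<open>nrm\<close> to the Euclidean
  norm.\<close>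

lemma norm_le_nrm: "\<exists>K>0. \<forall>a. norm a \<le> K * nrm a"
proof -
  have "\<exists>x\<in>sphere 0 1. \<forall>y\<in>sphere (0::'a) 1. nrm x \<le> nrm y"
    by (rule continuous_attains_inf) (auto simp: continuous_on_nrm)
  then obtain x where x: "norm x = 1" "\<And>y. norm y = 1 \<Longrightarrow> nrm x \<le> nrm y" by auto
  have p: "nrm x > 0" using x(1) by (intro nrm_pos) auto
  have "norm a \<le> (1 / nrm x) * nrm a" for a
  proof (cases "a = 0")
    case False
    then have "nrm x \<le> nrm ((1 / norm a) *\<^sub>R a)" by (intro x(2)) simp
    with False p show ?thesis by (simp add: nrm_scaleR field_simps)
  qed (simp add: nrm_zero)
  with p show ?thesis by (intro exI[of _ "1 / nrm x"]) auto
qed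

lemma tendsto_nrm:
  assumes "X \<longlonglongrightarrow> a" shows "(\<lambda>k. nrm (X k - a)) \<longlonglongrightarrow> 0"
  using continuous_on_tendsto_compose[OF continuous_on_nrm[of UNIV], of "\<lambda>k. X k - a" 0 sequentially]
    assms by (simp add: LIM_zero nrm_zero)

lemma nrm_tendsto_0D:
  assumes "(\<lambda>k. nrm (X k - a)) \<longlonglongrightarrow> 0" shows "X \<longlonglongrightarrow> a"
proof -
  obtain K where K: "K > 0" "\<And>a. norm a \<le> K * nrm a" using norm_le_nrm by auto
  have "(\<lambda>k. X k - a) \<longlonglongrightarrow> 0"
  proof (rule Lim_null_comparison)
    show "(\<lambda>k. K * nrm (X k - a)) \<longlonglongrightarrow> 0"
      using tendsto_mult_right_zero[OF assms] by simp
  qed (use K(2) in auto)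
  then show ?thesis by (rule LIM_zero_cancel)
qed

lemma bij_A: "bij A"
proof -
  have "inj A"
    using pos linear_injective_0[OF lin] by fastforce
  then show ?thesis using linear_injective_imp_surjective[OF lin] by (simp add: bij_def)
qed

lemma A_inv: "A (inv A q) = q" "inv A (A q) = q"
  using bij_A by (simp_all add: bij_def surj_f_inv_f)

lemma linear_inv: "linear (inv A)"
  by (rule linearI; rule injD[OF bij_is_inj[OF bij_A]])
    (simp_all add: A_inv linear_add[OF lin] linear_scale[OF lin])

end

section \<open>Relaxed splitting with summable errors\<close>

text \<open>Subtracting the partial sums of \<open>\<epsilon>\<close> leaves a decreasing sequence
  bounded below.\<close>

lemma quasi_decreasing_convergent:
  fixes a \<epsilon> :: "nat \<Rightarrow> real"
  assumes "\<And>k. 0 \<le> a k" "\<And>k. a (Suc k) \<le> a k + \<epsilon> k" "\<And>k. 0 \<le> \<epsilon> k" "summable \<epsilon>"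
  shows "convergent a"
proof -
  define b where "b k = a k - (\<Sum>j<k. \<epsilon> j)" for k
  have "decseq b" by (rule decseq_SucI) (use assms(2) in \<open>auto simp: b_def algebra_simps\<close>)
  moreover have "- suminf \<epsilon> \<le> b k" for k
    using assms(1)[of k] sum_le_suminf[OF assms(4), of "{..<k}"] assms(3) by (simp add: b_def)
  ultimately obtain L where "b \<longlonglongrightarrow> L" using decseq_convergent by blast
  then have "(\<lambda>k. b k + (\<Sum>j<k. \<epsilon> j)) \<longlonglongrightarrow> L + suminf \<epsilon>"
    by (intro tendsto_add summable_LIMSEQ assms(4))
  then show ?thesis by (auto simp: b_def convergent_def)
qed

text \<open>To be read with \<open>a\<close> as the distance to a target, \<open>t\<close> as the
  distance after an error-free step, \<open>\<epsilon>\<close> as the error and \<open>b\<close> as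
  the guaranteed decrease. Since \<open>a (Suc k) - \<epsilon> k \<le> t k \<le> a k\<close>, both
  distances have the same limit, which squeezes \<open>b\<close> to zero.\<close>

lemma quasi_fejer:
  fixes a t b \<epsilon> :: "nat \<Rightarrow> real"
  assumes a: "\<And>k. 0 \<le> a k" and t: "\<And>k. 0 \<le> t k"
    and step: "\<And>k. a (Suc k) \<le> t k + \<epsilon> k"
    and dec: "\<And>k. (t k)\<^sup>2 + b k \<le> (a k)\<^sup>2" and b: "\<And>k. 0 \<le> b k"
    and eps: "\<And>k. 0 \<le> \<epsilon> k" "summable \<epsilon>"
  shows "convergent a" and "b \<longlonglongrightarrow> 0"
proof -
  have ta: "t k \<le> a k" for k
  proof (rule power2_le_imp_le)
    show "(t k)\<^sup>2 \<le> (a k)\<^sup>2" using dec[of k] b[of k] by simp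
  qed (rule a)
  have sa: "a (Suc k) \<le> a k + \<epsilon> k" for k
    using step[of k] ta[of k] by simp
  show c: "convergent a"
    by (rule quasi_decreasing_convergent[OF a sa eps])
  then obtain L where L: "a \<longlonglongrightarrow> L" by (auto simp: convergent_def)
  have "(\<lambda>k. a (Suc k) - \<epsilon> k) \<longlonglongrightarrow> L - 0"
    by (intro tendsto_diff summable_LIMSEQ_zero eps LIMSEQ_Suc L)
  then have aL: "(\<lambda>k. a (Suc k) - \<epsilon> k) \<longlonglongrightarrow> L" by simp
  have tL: "t \<longlonglongrightarrow> L"
    by (rule tendsto_sandwich[OF _ _ aL L]) (use ta step in \<open>auto simp: diff_le_eq\<close>)
  have "(\<lambda>k. (a k)\<^sup>2 - (t k)\<^sup>2) \<longlonglongrightarrow> L\<^sup>2 - L\<^sup>2" by (intro tendsto_intros L tL)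
  then have lim: "(\<lambda>k. (a k)\<^sup>2 - (t k)\<^sup>2) \<longlonglongrightarrow> 0" by simp
  show "b \<longlonglongrightarrow> 0"
    by (rule tendsto_sandwich[OF _ _ tendsto_const lim])
      (use b dec in \<open>auto simp: le_diff_eq add.commute\<close>)
qed

text \<open>\<open>\<Gamma>\<close> abstracts the pairs \<open>(q, y)\<close> with
  \<open>- y\<close> a subgradient of the dual function at \<open>q\<close>; the sign turns
  monotonicity into \<open>antimono\<close>. The error \<open>e\<close> collects the inexactness of
  the subproblems.\<close>

locale relaxed_splitting = spd_form A for A :: "'a::euclidean_space \<Rightarrow> 'a" +
  fixes V :: "'a set" and \<Gamma> :: "('a \<times> 'a) set"
    and z u d e :: "nat \<Rightarrow> 'a" and \<nu> :: "nat \<Rightarrow> real" and l \<omega> :: real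
  assumes V: "subspace V"
    and antimono: "\<And>q y q' y'. (q, y) \<in> \<Gamma> \<Longrightarrow> (q', y') \<in> \<Gamma> \<Longrightarrow> (q - q') \<bullet> (y - y') \<le> 0"
    and closed: "closed \<Gamma>"
    and z: "\<And>k. z k \<in> V"
    and u: "\<And>k w. w \<in> V \<Longrightarrow> form w (u k) = 0"
    and graph: "\<And>k. (A (u k + d k), z k + d k) \<in> \<Gamma>"
    and step: "\<And>k. z (Suc k) + u (Suc k) = z k + u k + \<nu> k *\<^sub>R d k + e k"
    and l: "0 < l" "\<And>k. l \<le> \<nu> k"
    and \<omega>: "0 < \<omega>" "\<And>k. \<nu> k \<le> 2 - \<omega>"
    and e: "summable (\<lambda>k. nrm (e k))"
begin

text \<open>The complement of \<open>V\<close> for the form; \<open>A\<close> maps it onto the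
  Euclidean orthogonal complement of \<open>V\<close>.\<close>

definition U :: "'a set" where "U = {u. \<forall>w\<in>V. form w u = 0}"

lemma u_in_U: "u k \<in> U"
  by (simp add: U_def u)

lemma subspace_U: "subspace U"
  by (auto simp: U_def subspace_def form_def inner_add_right linear_0[OF lin] linear_add[OF lin]
      linear_scale[OF lin])

lemma form_V_U: "w \<in> V \<Longrightarrow> u' \<in> U \<Longrightarrow> form w u' = 0"
  by (simp add: U_def)

lemma nrm_sum_sq:
  assumes "w \<in> V" "u' \<in> U" shows "(nrm (w + u'))\<^sup>2 = (nrm w)\<^sup>2 + (nrm u')\<^sup>2"
  using form_V_U[OF assms] by (simp add: nrm_sq form_bilinear form_commute[of u' w])

text \<open>By Pythagoras, bounds and limits for the sum \<open>s k\<close> pass to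
  \<open>z k\<close> and \<open>u k\<close> separately.\<close>

lemma nrm_le_nrm_sum:
  assumes "w \<in> V" "u' \<in> U" shows "nrm w \<le> nrm (w + u')" "nrm u' \<le> nrm (w + u')"
  by (rule power2_le_imp_le; simp add: nrm_sum_sq[OF assms] nrm_nonneg)+

abbreviation s :: "nat \<Rightarrow> 'a" where "s k \<equiv> z k + u k"

text \<open>The offset \<open>g\<close> is \<open>0\<close> at exact solutions and \<open>\<epsilon> (z' + u')\<close> at regularized ones.\<close>

lemma cocoercive:
  assumes "z' \<in> V" "u' \<in> U" "(A (u' + g), z' + g) \<in> \<Gamma>"
  shows "form (d k - g) (s k - (z' + u')) \<le> - (nrm (d k - g))\<^sup>2"
proof -
  define a where "a = d k - g"
  define Z where "Z = z k - z'"
  define Y where "Y = u k - u'"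
  have ZV: "Z \<in> V" "Y \<in> U"
    using z u_in_U assms by (auto simp: Z_def Y_def intro!: subspace_diff V subspace_U)
  have "(A (u k + d k) - A (u' + g)) \<bullet> (z k + d k - (z' + g)) \<le> 0"
    by (rule antimono[OF graph assms(3)])
  also have "A (u k + d k) - A (u' + g) = A (Y + a)"
    by (simp add: linear_diff[OF lin, symmetric] Y_def a_def algebra_simps)
  also have "z k + d k - (z' + g) = Z + a" by (simp add: Z_def a_def)
  finally have "form (Z + a) (Y + a) \<le> 0" by (simp add: form_def inner_commute)
  \<comment> \<open>\<open>form Z Y\<close> vanishes because \<open>Z\<close> lies in
    \<open>V\<close> and \<open>Y\<close> in \<open>U\<close>, so the two mixed terms combine into a
    product with the sum.\<close>
  then have "form a (Z + Y) + form a a \<le> 0"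
    using form_V_U[OF ZV] form_commute[of Z a] by (simp add: form_bilinear)
  moreover have "Z + Y = s k - (z' + u')" by (simp add: Z_def Y_def)
  ultimately show ?thesis by (simp add: nrm_sq a_def)
qed

lemma \<nu>_bounds: "0 < \<nu> k" "\<nu> k \<le> 2"
  using l(1) l(2)[of k] \<omega>(1) \<omega>(2)[of k] by auto

text \<open>Expansion of the square, with cocoercivity applied to the part \<open>d k - g\<close> of
  the step. For \<open>g = 0\<close> this is the Fejer estimate; the other terms are the price, or
  the gain, of an offset.\<close>

lemma descent:
  assumes "z' \<in> V" "u' \<in> U" "(A (u' + g), z' + g) \<in> \<Gamma>"
  defines "t \<equiv> z' + u'"
  shows "(nrm (s k + \<nu> k *\<^sub>R d k - t))\<^sup>2 \<le> (nrm (s k - t))\<^sup>2 + 2 * \<nu> k * form g (s k - t)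
    - \<nu> k * (2 - \<nu> k) * (nrm (d k - g))\<^sup>2 + 2 * (\<nu> k)\<^sup>2 * (nrm (d k - g) * nrm g)
    + (\<nu> k)\<^sup>2 * (nrm g)\<^sup>2"
proof -
  define a where "a = d k - g"
  define S where "S = s k - t"
  have d: "d k = a + g" by (simp add: a_def)
  have co: "form a S \<le> - form a a"
    using cocoercive[OF assms(1-3), of k] by (simp add: a_def S_def t_def nrm_sq)
  have "s k + \<nu> k *\<^sub>R d k - t = S + \<nu> k *\<^sub>R (a + g)" by (simp add: S_def d)
  then have "(nrm (s k + \<nu> k *\<^sub>R d k - t))\<^sup>2 = form (S + \<nu> k *\<^sub>R (a + g)) (S + \<nu> k *\<^sub>R (a + g))"
    by (simp only: nrm_sq)
  also have "\<dots> = form S S + 2 * \<nu> k * (form a S + form g S)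
      + (\<nu> k)\<^sup>2 * (form a a + 2 * form a g + form g g)"
    by (simp add: form_bilinear form_commute[of S a] form_commute[of S g] form_commute[of g a]
        algebra_simps power2_eq_square)
  \<comment> \<open>The regrouping isolates \<open>form a S + form a a\<close>, nonpositive by
    \<open>co\<close>; the product \<open>form a g\<close> is left to Cauchy-Schwarz.\<close>
  also have "\<dots> = form S S + 2 * \<nu> k * form g S - \<nu> k * (2 - \<nu> k) * form a a
      + 2 * ((\<nu> k)\<^sup>2 * form a g) + (\<nu> k)\<^sup>2 * form g g + 2 * (\<nu> k * (form a S + form a a))"
    by (simp add: algebra_simps power2_eq_square)
  finally have eq: "(nrm (s k + \<nu> k *\<^sub>R d k - t))\<^sup>2 = form S S + 2 * \<nu> k * form g S
      - \<nu> k * (2 - \<nu> k) * form a a + 2 * ((\<nu> k)\<^sup>2 * form a g) + (\<nu> k)\<^sup>2 * form g g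
      + 2 * (\<nu> k * (form a S + form a a))" .
  have "\<nu> k * (form a S + form a a) \<le> 0"
    using co \<nu>_bounds[of k] by (intro mult_nonneg_nonpos) auto
  moreover have "(\<nu> k)\<^sup>2 * form a g \<le> (\<nu> k)\<^sup>2 * (nrm a * nrm g)"
    by (intro mult_left_mono form_le_nrm) auto
  moreover have "2 * (\<nu> k)\<^sup>2 * (nrm a * nrm g) = 2 * ((\<nu> k)\<^sup>2 * (nrm a * nrm g))" by simp
  ultimately show ?thesis
    unfolding eq a_def[symmetric] S_def[symmetric] nrm_sq[of a] nrm_sq[of S] nrm_sq[of g]
    by linarith
qed

lemma nrm_step: "nrm (s (Suc k) - t) \<le> nrm (s k + \<nu> k *\<^sub>R d k - t) + nrm (e k)"
  using nrm_triangle[of "s k + \<nu> k *\<^sub>R d k - t" "e k"] step[of k] by (simp add: algebra_simps)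

text \<open>With \<open>g = 0\<close> the decrease is at least
  \<open>l * \<omega> * (nrm (d k))\<^sup>2\<close>, as the relaxation factors stay away from both 0
  and 2.\<close>

lemma fejer_solution:
  assumes "z' \<in> V" "u' \<in> U" "(A u', z') \<in> \<Gamma>"
  shows "convergent (\<lambda>k. nrm (s k - (z' + u')))" and "(\<lambda>k. nrm (d k)) \<longlonglongrightarrow> 0"
proof -
  have dec: "(nrm (s k + \<nu> k *\<^sub>R d k - (z' + u')))\<^sup>2 + l * \<omega> * (nrm (d k))\<^sup>2 \<le> (nrm (s k - (z' + u')))\<^sup>2"
    for k
  proof -
    have "l * \<omega> \<le> \<nu> k * (2 - \<nu> k)"
      using l(1) l(2)[of k] \<omega>(1) \<omega>(2)[of k] by (intro mult_mono) auto
    then have "l * \<omega> * (nrm (d k))\<^sup>2 \<le> \<nu> k * (2 - \<nu> k) * (nrm (d k))\<^sup>2"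
      by (intro mult_right_mono) auto
    then show ?thesis
      using descent[of z' u' 0 k] assms by (simp add: nrm_zero form_def)
  qed
  have b: "0 \<le> l * \<omega> * (nrm (d k))\<^sup>2" for k using l(1) \<omega>(1) by simp
  note q = quasi_fejer[OF nrm_nonneg nrm_nonneg nrm_step dec b nrm_nonneg e]
  show "convergent (\<lambda>k. nrm (s k - (z' + u')))" by (rule q(1))
  have "(\<lambda>k. l * \<omega> * (nrm (d k))\<^sup>2 / (l * \<omega>)) \<longlonglongrightarrow> 0"
    using tendsto_divide_zero[OF q(2)] .
  then have "(\<lambda>k. (nrm (d k))\<^sup>2) \<longlonglongrightarrow> 0" using l(1) \<omega>(1) by simp
  then show "(\<lambda>k. nrm (d k)) \<longlonglongrightarrow> 0"
    using tendsto_real_sqrt[of "\<lambda>k. (nrm (d k))\<^sup>2" 0] by (simp add: nrm_nonneg)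
qed

text \<open>Compactness and closedness of \<open>\<Gamma>\<close>. It serves twice: with the
  residuals \<open>d\<close> as vanishing offsets, and with the offsets of regularized
  solutions.\<close>

lemma cluster_point:
  assumes Z: "\<And>n. Z n \<in> V" and Y: "\<And>n. Y n \<in> U" and g: "g \<longlonglongrightarrow> 0"
    and G: "\<And>n. (A (Y n + g n), Z n + g n) \<in> \<Gamma>"
    and R: "\<And>n. nrm (Z n + Y n) \<le> R"
  obtains z' u' r where "z' \<in> V" "u' \<in> U" "(A u', z') \<in> \<Gamma>" "strict_mono (r :: nat \<Rightarrow> nat)"
    "(Z \<circ> r) \<longlonglongrightarrow> z'" "(Y \<circ> r) \<longlonglongrightarrow> u'"
proof -
  obtain K where K: "K > 0" "\<And>a. norm a \<le> K * nrm a" using norm_le_nrm by auto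
  have "norm (Z n) \<le> K * R" "norm (Y n) \<le> K * R" for n
    using K nrm_le_nrm_sum[OF Z Y, of n] R[of n]
    by (meson mult_left_mono order_trans less_imp_le)+
  then have "\<forall>n. (Z n, Y n) \<in> cball 0 (K * R) \<times> cball 0 (K * R)" by simp
  moreover have "seq_compact (cball (0::'a) (K * R) \<times> cball (0::'a) (K * R))"
    by (intro compact_imp_seq_compact compact_Times) auto
  ultimately obtain zu r where r: "strict_mono (r :: nat \<Rightarrow> nat)"
    and lim: "((\<lambda>n. (Z n, Y n)) \<circ> r) \<longlonglongrightarrow> zu"
    by (meson seq_compactE)
  define z' u' where "z' = fst zu" and "u' = snd zu"
  have lz: "(Z \<circ> r) \<longlonglongrightarrow> z'" and lu: "(Y \<circ> r) \<longlonglongrightarrow> u'"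
    using tendsto_fst[OF lim] tendsto_snd[OF lim] by (simp_all add: z'_def u'_def o_def)
  have lg: "(g \<circ> r) \<longlonglongrightarrow> 0" by (rule LIMSEQ_subseq_LIMSEQ[OF g r])
  have "z' \<in> V"
    by (rule closed_sequentially[OF closed_subspace[OF V] _ lz]) (simp add: Z)
  moreover have "u' \<in> U"
    by (rule closed_sequentially[OF closed_subspace[OF subspace_U] _ lu]) (simp add: Y)
  moreover have "(A u', z') \<in> \<Gamma>"
  proof (rule closed_sequentially[OF closed])
    show "(A ((Y \<circ> r) n + (g \<circ> r) n), (Z \<circ> r) n + (g \<circ> r) n) \<in> \<Gamma>" for n
      using G by simp
    have "(\<lambda>n. (Y \<circ> r) n + (g \<circ> r) n) \<longlonglongrightarrow> u'" using tendsto_add[OF lu lg] by simp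
    then have "(\<lambda>n. A ((Y \<circ> r) n + (g \<circ> r) n)) \<longlonglongrightarrow> A u'"
      by (rule bounded_linear.tendsto[OF linear_conv_bounded_linear[THEN iffD1, OF lin]])
    moreover have "(\<lambda>n. (Z \<circ> r) n + (g \<circ> r) n) \<longlonglongrightarrow> z'" using tendsto_add[OF lz lg] by simp
    ultimately show "(\<lambda>n. (A ((Y \<circ> r) n + (g \<circ> r) n), (Z \<circ> r) n + (g \<circ> r) n)) \<longlonglongrightarrow> (A u', z')"
      by (rule tendsto_Pair)
  qed
  ultimately show ?thesis by (rule that[OF _ _ _ r lz lu])
qed

text \<open>Opial's argument: a cluster point of the iterates is itself a solution, so the distance
  to it converges; along a subsequence it tends to zero, hence along the whole sequence.\<close>

theorem converges:
  assumes "z' \<in> V" "u' \<in> U" "(A u', z') \<in> \<Gamma>"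
  obtains zs us where "zs \<in> V" "us \<in> U" "(A us, zs) \<in> \<Gamma>" "z \<longlonglongrightarrow> zs" "u \<longlonglongrightarrow> us" "d \<longlonglongrightarrow> 0"
proof -
  have d: "d \<longlonglongrightarrow> 0"
    using nrm_tendsto_0D[of d 0] fejer_solution(2)[OF assms] by simp
  obtain R where R: "\<And>k. nrm (s k - (z' + u')) \<le> R"
    using convergent_imp_Bseq[OF fejer_solution(1)[OF assms]] nrm_nonneg
    by (auto simp: Bseq_def)
  have "nrm (s k) \<le> R + nrm (z' + u')" for k
    using nrm_triangle[of "s k - (z' + u')" "z' + u'"] R[of k] by simp
  from cluster_point[OF z u_in_U d graph this]
  obtain zs us r where c: "zs \<in> V" "us \<in> U" "(A us, zs) \<in> \<Gamma>" "strict_mono (r :: nat \<Rightarrow> nat)"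
    "(z \<circ> r) \<longlonglongrightarrow> zs" "(u \<circ> r) \<longlonglongrightarrow> us" by blast
  obtain L where L: "(\<lambda>k. nrm (s k - (zs + us))) \<longlonglongrightarrow> L"
    using fejer_solution(1)[OF c(1-3)] by (auto simp: convergent_def)
  have "(\<lambda>n. (z \<circ> r) n + (u \<circ> r) n) \<longlonglongrightarrow> zs + us" by (intro tendsto_add c)
  then have "(\<lambda>n. nrm ((z \<circ> r) n + (u \<circ> r) n - (zs + us))) \<longlonglongrightarrow> 0" by (rule tendsto_nrm)
  moreover have "(\<lambda>n. nrm ((z \<circ> r) n + (u \<circ> r) n - (zs + us))) \<longlonglongrightarrow> L"
    using LIMSEQ_subseq_LIMSEQ[OF L c(4)] by (simp add: o_def)
  ultimately have "L = 0" using LIMSEQ_unique by blast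
  with L have L0: "(\<lambda>k. nrm (s k - (zs + us))) \<longlonglongrightarrow> 0" by simp
  have split: "s k - (zs + us) = (z k - zs) + (u k - us)" for k by simp
  have parts: "z k - zs \<in> V" "u k - us \<in> U" for k
    using z u_in_U c by (auto intro!: subspace_diff V subspace_U)
  have le: "nrm (z k - zs) \<le> nrm (s k - (zs + us))" "nrm (u k - us) \<le> nrm (s k - (zs + us))" for k
    unfolding split by (rule nrm_le_nrm_sum[OF parts])+
  have "z \<longlonglongrightarrow> zs"
    by (rule nrm_tendsto_0D, rule tendsto_sandwich[OF _ _ tendsto_const L0])
      (use le nrm_nonneg in auto)
  moreover have "u \<longlonglongrightarrow> us"
    by (rule nrm_tendsto_0D, rule tendsto_sandwich[OF _ _ tendsto_const L0])
      (use le nrm_nonneg in auto)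
  ultimately show ?thesis by (rule that[OF c(1-3) _ _ d])
qed

text \<open>The bound is negative once \<open>t\<close> is longer than \<open>a\<close>: the offset
  then contributes a decrease in \<open>descent\<close>.\<close>

lemma form_perturbation_le: "form (\<epsilon> *\<^sub>R t) (a - t) \<le> \<epsilon> * nrm t * (nrm a - nrm t)" if "0 \<le> \<epsilon>"
proof -
  have "form (\<epsilon> *\<^sub>R t) (a - t) = \<epsilon> * (form t a - nrm t * nrm t)"
    unfolding form_scaleR_left form_diff_right nrm_sq[unfolded power2_eq_square]
    by (rule right_diff_distrib[symmetric])
  also have "\<dots> \<le> \<epsilon> * (nrm t * nrm a - nrm t * nrm t)"
    using that form_le_nrm[of t a] by (intro mult_left_mono) auto
  finally show ?thesis by (simp add: algebra_simps)
qed

text \<open>The bound is independent of \<open>\<epsilon>\<close>. Beyond it, the gain from the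
  offset, linear in its length \<open>\<delta>\<close>, outweighs the terms quadratic in
  \<open>\<delta>\<close>, and the squared distance would drop by \<open>2 * l * \<delta>\<close> at
  every step.\<close>

lemma perturbed_solution_bounded:
  assumes R: "\<And>k. nrm (s k) \<le> R"
    and eps: "0 < \<epsilon>" and V': "z' \<in> V" "u' \<in> U"
    and G: "(A (u' + \<epsilon> *\<^sub>R (z' + u')), z' + \<epsilon> *\<^sub>R (z' + u')) \<in> \<Gamma>"
  shows "nrm (z' + u') \<le> 2 * R + 3 * (2 / \<omega> + 1) * nrm (d 0) + 1"
proof (rule ccontr)
  assume large: "\<not> ?thesis"
  define t where "t = z' + u'"
  define g where "g = \<epsilon> *\<^sub>R t"
  define T where "T = nrm t"
  define \<delta> where "\<delta> = \<epsilon> * T"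
  define C where "C = 4 / \<omega> + 2"
  define D where "D = nrm (d 0)"
  have C2: "C / 2 = 2 / \<omega> + 1" by (simp add: C_def field_simps)
  have R0: "0 \<le> R" using R[of 0] nrm_nonneg[of "s 0"] by simp
  have C0: "0 < C" using \<omega>(1) by (simp add: C_def add_pos_pos)
  have D0: "0 \<le> D" by (simp add: D_def nrm_nonneg)
  have T: "T > 2 * R + 3 * (C / 2) * D + 1"
    using large unfolding C2 by (simp add: T_def t_def D_def)
  have CD: "0 \<le> 3 * (C / 2) * D" using C0 D0 by simp
  have T1: "T \<ge> 2 * R" "T > 0" using T CD R0 by linarith+
  have \<delta>0: "\<delta> > 0" using eps T1 by (simp add: \<delta>_def)
  have ng: "nrm g = \<delta>" using eps by (simp add: g_def nrm_scaleR \<delta>_def T_def)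
  have fg: "form g (s k - t) \<le> \<delta> * (R - T)" for k
  proof -
    have "form g (s k - t) \<le> \<delta> * (nrm (s k) - T)"
      using form_perturbation_le[of \<epsilon> t "s k"] eps by (simp add: g_def \<delta>_def T_def)
    also have "\<dots> \<le> \<delta> * (R - T)" using R[of k] \<delta>0 by (intro mult_left_mono) auto
    finally show ?thesis .
  qed
  \<comment> \<open>Cocoercivity at the initial iterate alone bounds \<open>\<delta>\<close> by
    \<open>3 * D\<close>, whatever \<open>\<epsilon>\<close> is.\<close>
  have "form (d 0 - g) (s 0 - t) \<le> 0"
    using cocoercive[OF V' G, of 0] by (simp add: g_def t_def) (meson neg_le_0_iff_le order_trans zero_le_power2)
  then have "form (d 0) (s 0 - t) \<le> form g (s 0 - t)" by (simp add: form_diff_left)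
  also have "\<dots> \<le> \<delta> * (R - T)" by (rule fg)
  also have "\<dots> \<le> \<delta> * (- (T / 2))" using T1 \<delta>0 by (intro mult_left_mono) auto
  finally have low: "form (d 0) (s 0 - t) \<le> - (\<delta> * T / 2)" by simp
  have "- form (d 0) (s 0 - t) = form (d 0) (t - s 0)" by (simp add: form_bilinear)
  also have "\<dots> \<le> D * nrm (t - s 0)" unfolding D_def by (rule form_le_nrm)
  also have "\<dots> \<le> D * (T + R)"
    using nrm_diff_triangle[of t "s 0"] R[of 0] D0 by (intro mult_left_mono) (auto simp: T_def)
  also have "\<dots> \<le> D * (3 / 2 * T)" using T1 D0 by (intro mult_left_mono) auto
  finally have "\<delta> * T / 2 \<le> D * (3 / 2 * T)" using low by linarith
  then have "\<delta> \<le> 3 * D" using T1 by (simp add: field_simps)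
  then have "C / 2 * \<delta> \<le> C / 2 * (3 * D)" using C0 by (intro mult_left_mono) auto
  \<comment> \<open>The threshold for \<open>T\<close> is chosen to produce this margin.\<close>
  then have gap: "R - T + C / 2 * \<delta> \<le> - 1" using T R0 by (simp add: algebra_simps)
  have dec: "(nrm (s k + \<nu> k *\<^sub>R d k - t))\<^sup>2 + 2 * l * \<delta> \<le> (nrm (s k - t))\<^sup>2" for k
  proof -
    define a where "a = nrm (d k - g)"
    have a0: "a \<ge> 0" by (simp add: a_def nrm_nonneg)
    \<comment> \<open>Young's inequality: the contraction term absorbs the cross term
      \<open>4 * a * \<delta>\<close> at the cost of \<open>4 / \<omega> * \<delta>\<^sup>2\<close>.
      That coefficient, plus 2 from \<open>\<nu> k * \<delta>\<^sup>2\<close>, is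
      \<open>C\<close>.\<close>
    have "0 \<le> (\<omega> * a - 2 * \<delta>)\<^sup>2" by simp
    then have "0 \<le> (\<omega> * a - 2 * \<delta>)\<^sup>2 / \<omega>" using \<omega>(1) by simp
    also have "\<dots> = \<omega> * a\<^sup>2 - 4 * a * \<delta> + 4 / \<omega> * \<delta>\<^sup>2"
      using \<omega>(1) by (simp add: field_simps power2_eq_square)
    finally have 1: "4 * a * \<delta> \<le> \<omega> * a\<^sup>2 + 4 / \<omega> * \<delta>\<^sup>2" by simp
    have 2: "\<omega> * a\<^sup>2 \<le> (2 - \<nu> k) * a\<^sup>2" using \<omega>(2)[of k] by (intro mult_right_mono) auto
    have 3: "\<nu> k * (a * \<delta>) \<le> 2 * (a * \<delta>)" "\<nu> k * \<delta>\<^sup>2 \<le> 2 * \<delta>\<^sup>2"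
      using \<nu>_bounds[of k] a0 \<delta>0 by (intro mult_right_mono; simp)+
    have "2 * \<delta> * (R - T) - (2 - \<nu> k) * a\<^sup>2 + 2 * \<nu> k * (a * \<delta>) + \<nu> k * \<delta>\<^sup>2
        \<le> 2 * \<delta> * (R - T) + C * \<delta>\<^sup>2"
      using 1 2 3 by (simp add: C_def algebra_simps)
    also have "\<dots> = 2 * \<delta> * (R - T + C / 2 * \<delta>)" by (simp add: algebra_simps power2_eq_square)
    also have "\<dots> \<le> 2 * \<delta> * (- 1)" using gap \<delta>0 by (intro mult_left_mono) auto
    finally have "\<nu> k * (2 * \<delta> * (R - T) - (2 - \<nu> k) * a\<^sup>2 + 2 * \<nu> k * (a * \<delta>) + \<nu> k * \<delta>\<^sup>2)
        \<le> \<nu> k * (2 * \<delta> * (- 1))"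
      using \<nu>_bounds[of k] by (intro mult_left_mono) auto
    also have "\<dots> \<le> - (2 * l * \<delta>)" using l(2)[of k] \<delta>0 by (simp add: mult.commute mult_left_mono)
    finally have 4: "\<nu> k * (2 * \<delta> * (R - T) - (2 - \<nu> k) * a\<^sup>2 + 2 * \<nu> k * (a * \<delta>) + \<nu> k * \<delta>\<^sup>2)
        \<le> - (2 * l * \<delta>)" .
    have 5: "2 * \<nu> k * form g (s k - t) \<le> 2 * \<nu> k * (\<delta> * (R - T))"
      using fg[of k] \<nu>_bounds[of k] by (intro mult_left_mono) auto
    have "(nrm (s k + \<nu> k *\<^sub>R d k - t))\<^sup>2 \<le> (nrm (s k - t))\<^sup>2 + 2 * \<nu> k * form g (s k - t)
        - \<nu> k * (2 - \<nu> k) * a\<^sup>2 + 2 * (\<nu> k)\<^sup>2 * (a * \<delta>) + (\<nu> k)\<^sup>2 * \<delta>\<^sup>2"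
      using descent[OF V' G, of k] by (simp add: g_def[symmetric] t_def[symmetric] a_def ng)
    then show ?thesis using 4 5 by (simp add: algebra_simps power2_eq_square)
  qed
  have b: "0 \<le> 2 * l * \<delta>" using l(1) \<delta>0 by simp
  \<comment> \<open>The decrease does not depend on the step, yet \<open>quasi_fejer\<close> forces
    it to vanish in the limit.\<close>
  have "(\<lambda>k::nat. 2 * l * \<delta>) \<longlonglongrightarrow> 0"
    by (rule quasi_fejer(2)[OF nrm_nonneg nrm_nonneg nrm_step dec b nrm_nonneg e])
  then show False using l(1) \<delta>0 by (simp add: LIMSEQ_const_iff)
qed

text \<open>Regularized solutions for \<open>\<epsilon> = 1 / (n + 1)\<close> stay in a fixed ball,
  so their offsets tend to zero and a cluster point solves the unperturbed inclusion.\<close>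

theorem bounded_imp_solution:
  assumes R: "\<And>k. nrm (s k) \<le> R"
    and ex: "\<And>\<epsilon>. 0 < \<epsilon> \<Longrightarrow> \<exists>z'\<in>V. \<exists>u'\<in>U.
      (A (u' + \<epsilon> *\<^sub>R (z' + u')), z' + \<epsilon> *\<^sub>R (z' + u')) \<in> \<Gamma>"
  shows "\<exists>z'\<in>V. \<exists>u'\<in>U. (A u', z') \<in> \<Gamma>"
proof -
  define \<epsilon> where "\<epsilon> n = 1 / real (Suc n)" for n
  have eps: "0 < \<epsilon> n" for n by (simp add: \<epsilon>_def)
  from ex[OF eps] obtain Z Y where Z: "\<And>n. Z n \<in> V" and Y: "\<And>n. Y n \<in> U"
    and G: "\<And>n. (A (Y n + \<epsilon> n *\<^sub>R (Z n + Y n)), Z n + \<epsilon> n *\<^sub>R (Z n + Y n)) \<in> \<Gamma>"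
    by metis
  define B where "B = 2 * R + 3 * (2 / \<omega> + 1) * nrm (d 0) + 1"
  have B: "nrm (Z n + Y n) \<le> B" for n
    unfolding B_def by (rule perturbed_solution_bounded[OF R eps Z Y G])
  have "(\<lambda>n. \<epsilon> n * B) \<longlonglongrightarrow> 0"
    unfolding \<epsilon>_def using tendsto_mult_left_zero[OF LIMSEQ_Suc[OF lim_1_over_n]] by simp
  then have "(\<lambda>n. nrm (\<epsilon> n *\<^sub>R (Z n + Y n) - 0)) \<longlonglongrightarrow> 0"
    by (rule tendsto_sandwich[OF _ _ tendsto_const, rotated 2])
      (use B eps in \<open>auto simp: nrm_nonneg nrm_scaleR less_imp_le intro!: mult_left_mono\<close>)
  then have g: "(\<lambda>n. \<epsilon> n *\<^sub>R (Z n + Y n)) \<longlonglongrightarrow> 0" by (rule nrm_tendsto_0D)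
  from cluster_point[OF Z Y g G B] show ?thesis by blast
qed

end

section \<open>Subgradients and conjugates\<close>

lemma epigraph_finite:
  assumes "f x \<noteq> - \<infinity>" "(x, t) \<in> ereal_epigraph f"
  obtains a where "f x = ereal a" "a \<le> t"
  using assms by (cases "f x") (auto simp: ereal_epigraph_def)

lemma epigraph_of_finite: "f x = ereal a \<Longrightarrow> (x, a) \<in> ereal_epigraph f"
  by (simp add: ereal_epigraph_def)

lemma proper_point:
  assumes "closed_proper_convex f"
  obtains x a where "f x = ereal a"
proof -
  obtain x where "f x \<noteq> \<infinity>" "f x \<noteq> - \<infinity>" using assms by (auto simp: closed_proper_convex_def)
  with that show ?thesis by (cases "f x") auto
qed

text \<open>Trades extended-real arithmetic for real inequalities over the epigraph.\<close>

lemma subdifferential_iff: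
  assumes "\<And>x. f x \<noteq> - \<infinity>" "f x = ereal a"
  shows "s \<in> subdifferential f x \<longleftrightarrow> (\<forall>w t. (w, t) \<in> ereal_epigraph f \<longrightarrow> a + s \<bullet> (w - x) \<le> t)"
proof
  assume L: "s \<in> subdifferential f x"
  have "a + s \<bullet> (w - x) \<le> t" if "(w, t) \<in> ereal_epigraph f" for w t
  proof -
    have "ereal (a + s \<bullet> (w - x)) \<le> f w" using L assms(2) by (simp add: subdifferential_def)
    also have "\<dots> \<le> ereal t" using that by (simp add: ereal_epigraph_def)
    finally show ?thesis by simp
  qed
  then show "\<forall>w t. (w, t) \<in> ereal_epigraph f \<longrightarrow> a + s \<bullet> (w - x) \<le> t" by blast
next
  assume R: "\<forall>w t. (w, t) \<in> ereal_epigraph f \<longrightarrow> a + s \<bullet> (w - x) \<le> t"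
  have "f x + ereal (s \<bullet> (w - x)) \<le> f w" for w
  proof (cases "f w")
    case (real t)
    with R epigraph_of_finite[of f, OF real] assms(2) show ?thesis by auto
  qed (use assms(1)[of w] in auto)
  then show "s \<in> subdifferential f x" by (simp add: subdifferential_def)
qed

lemma subdifferential_finite:
  assumes "closed_proper_convex f" "s \<in> subdifferential f x"
  obtains a where "f x = ereal a"
proof -
  obtain w b where "f w = ereal b" using proper_point[OF assms(1)] .
  moreover have "f x + ereal (s \<bullet> (w - x)) \<le> f w" using assms(2) by (simp add: subdifferential_def)
  ultimately have "f x + ereal (s \<bullet> (w - x)) \<le> ereal b" by simp
  then have "f x \<noteq> \<infinity>" by auto
  then show ?thesis using that assms(1) by (cases "f x") (auto simp: closed_proper_convex_def)
qed

lemma subdifferential_monotone: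
  assumes "closed_proper_convex f" "s \<in> subdifferential f x" "s' \<in> subdifferential f x'"
  shows "0 \<le> (s - s') \<bullet> (x - x')"
proof -
  have ninf: "\<And>x. f x \<noteq> - \<infinity>" using assms(1) by (simp add: closed_proper_convex_def)
  obtain a a' where a: "f x = ereal a" "f x' = ereal a'"
    using subdifferential_finite assms by metis
  have "a + s \<bullet> (x' - x) \<le> a'" "a' + s' \<bullet> (x - x') \<le> a"
    using assms(2,3) epigraph_of_finite[of f, OF a(1)] epigraph_of_finite[of f, OF a(2)]
    by (auto simp: subdifferential_iff[of f, OF ninf a(1)] subdifferential_iff[of f, OF ninf a(2)])
  then show ?thesis by (simp add: algebra_simps)
qed

text \<open>For each epigraph point \<open>(w, t)\<close> the subgradient inequality puts a point
  above \<open>X n\<close> into the epigraph, and this membership survives the limit because the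
  epigraph is closed.\<close>

lemma closed_subdifferential_graph:
  fixes f :: "'a::euclidean_space \<Rightarrow> ereal"
  assumes "closed_proper_convex f"
  shows "closed {(x, s). s \<in> subdifferential f x}"
  unfolding closed_sequential_limits
proof (intro allI impI, elim conjE)
  fix xs and l :: "'a \<times> 'a"
  assume G: "\<forall>n. xs n \<in> {(x, s). s \<in> subdifferential f x}" and lim: "xs \<longlonglongrightarrow> l"
  have ninf: "\<And>x. f x \<noteq> - \<infinity>" and cl: "closed (ereal_epigraph f)"
    using assms by (auto simp: closed_proper_convex_def)
  define X S where "X n = fst (xs n)" and "S n = snd (xs n)" for n
  define x s where "x = fst l" and "s = snd l"
  have X: "X \<longlonglongrightarrow> x" and S: "S \<longlonglongrightarrow> s"
    using tendsto_fst[OF lim] tendsto_snd[OF lim] by (simp_all add: X_def[abs_def] S_def[abs_def] x_def s_def)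
  have GS: "S n \<in> subdifferential f (X n)" for n
    using G[rule_format, of n] by (simp add: X_def S_def case_prod_unfold)
  have key: "(x, t - s \<bullet> (w - x)) \<in> ereal_epigraph f" if "(w, t) \<in> ereal_epigraph f" for w t
  proof (rule closed_sequentially[OF cl])
    show "(X n, t - S n \<bullet> (w - X n)) \<in> ereal_epigraph f" for n
    proof -
      obtain a where a: "f (X n) = ereal a" using subdifferential_finite[OF assms GS] .
      then show ?thesis using GS[of n] that
        by (auto simp: subdifferential_iff[of f, OF ninf a] ereal_epigraph_def le_diff_eq)
    qed
    show "(\<lambda>n. (X n, t - S n \<bullet> (w - X n))) \<longlonglongrightarrow> (x, t - s \<bullet> (w - x))"
      by (intro tendsto_intros X S)
  qed
  have "s \<in> subdifferential f x"
  proof -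
    \<comment> \<open>One point of finiteness suffices for \<open>key\<close> to make
      \<open>f x\<close> finite.\<close>
    obtain w t where "f w = ereal t" using proper_point[OF assms] .
    then obtain a where a: "f x = ereal a"
      using key epigraph_of_finite epigraph_finite ninf by metis
    then show ?thesis using key by (auto simp: subdifferential_iff[of f, OF ninf a] ereal_epigraph_def le_diff_eq)
  qed
  then show "l \<in> {(x, s). s \<in> subdifferential f x}" by (simp add: x_def s_def case_prod_unfold)
qed

text \<open>First-order optimality for \<open>f + q\<close>, where \<open>q\<close> is exactly
  quadratic along rays from \<open>x\<close> with gradient \<open>g\<close>. A violated subgradient
  inequality would give a decrease of first order along a segment, against a second-order
  remainder.\<close>

lemma minimizer_subgradient:
  fixes f :: "'a::real_inner \<Rightarrow> ereal"
  assumes f: "closed_proper_convex f" and fx: "f x = ereal a"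
    and min: "\<And>w t. (w, t) \<in> ereal_epigraph f \<Longrightarrow> a + q x \<le> t + q w"
    and q: "\<And>w \<theta>. q (x + \<theta> *\<^sub>R w) = q x + \<theta> * (g \<bullet> w) + \<theta>\<^sup>2 * r w"
  shows "- g \<in> subdifferential f x"
proof -
  have ninf: "\<And>x. f x \<noteq> - \<infinity>" and cv: "convex (ereal_epigraph f)"
    using f by (auto simp: closed_proper_convex_def)
  have "a \<le> t + g \<bullet> (w - x)" if wt: "(w, t) \<in> ereal_epigraph f" for w t
  proof (rule ccontr)
    define \<kappa> where "\<kappa> = a - (t + g \<bullet> (w - x))"
    define \<rho> where "\<rho> = \<bar>r (w - x)\<bar> + \<kappa>"
    assume "\<not> ?thesis"
    then have \<kappa>: "\<kappa> > 0" by (simp add: \<kappa>_def)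
    then have \<rho>: "\<rho> > 0" "\<kappa> \<le> \<rho>" "r (w - x) < \<rho>" by (auto simp: \<rho>_def)
    \<comment> \<open>Small enough that the remainder \<open>\<theta> * r (w - x)\<close> stays
      below the violation \<open>\<kappa>\<close>, and at most 1.\<close>
    define \<theta> where "\<theta> = \<kappa> / \<rho>"
    have \<theta>: "0 < \<theta>" "\<theta> \<le> 1" using \<kappa> \<rho> by (auto simp: \<theta>_def)
    have "(1 - \<theta>) *\<^sub>R (x, a) + \<theta> *\<^sub>R (w, t) \<in> ereal_epigraph f"
      using \<theta> convexD[OF cv epigraph_of_finite[of f, OF fx] wt] by simp
    moreover have "(1 - \<theta>) *\<^sub>R x + \<theta> *\<^sub>R w = x + \<theta> *\<^sub>R (w - x)" by (simp add: algebra_simps)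
    ultimately have "a + q x \<le> ((1 - \<theta>) * a + \<theta> * t) + q (x + \<theta> *\<^sub>R (w - x))"
      by (intro min) simp
    then have "0 \<le> \<theta> * (- \<kappa> + \<theta> * r (w - x))"
      unfolding q by (simp add: \<kappa>_def algebra_simps power2_eq_square)
    then have "\<kappa> \<le> \<theta> * r (w - x)" using \<theta> by (simp add: zero_le_mult_iff)
    also have "\<dots> < \<theta> * \<rho>" using \<theta> \<rho> by simp
    also have "\<dots> = \<kappa>" using \<rho> by (simp add: \<theta>_def)
    finally show False by simp
  qed
  then show ?thesis by (auto simp: subdifferential_iff[of f, OF ninf fx] algebra_simps)
qed

text \<open>The minimum is taken over the epigraph, where the objective is real and continuous;
  coercivity bounds a sublevel set in both coordinates.\<close>

lemma coercive_minimizer: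
  fixes f :: "'a::euclidean_space \<Rightarrow> ereal"
  assumes f: "closed_proper_convex f" and q: "continuous_on UNIV q"
    and coercive: "\<And>w t. (w, t) \<in> ereal_epigraph f \<Longrightarrow> \<kappa> * (norm w)\<^sup>2 + m \<bullet> w - b \<le> t + q w"
    and \<kappa>: "0 < \<kappa>"
  obtains x a where "f x = ereal a"
    "\<And>w t. (w, t) \<in> ereal_epigraph f \<Longrightarrow> a + q x \<le> t + q w"
proof -
  have ninf: "\<And>x. f x \<noteq> - \<infinity>" and cl: "closed (ereal_epigraph f)"
    using f by (auto simp: closed_proper_convex_def)
  obtain x0 t0 where "f x0 = ereal t0" using proper_point[OF f] .
  then have e0: "(x0, t0) \<in> ereal_epigraph f" by (rule epigraph_of_finite)
  define m0 where "m0 = t0 + q x0"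
  define K where "K = ereal_epigraph f \<inter> {p. snd p + q (fst p) \<le> m0}"
  define C where "C = \<bar>m0\<bar> + \<bar>b\<bar>"
  \<comment> \<open>Beyond this radius the quadratic term exceeds
    \<open>norm m * norm w + C\<close>; the summand 1 gives \<open>C \<le> C * norm w\<close>
    there.\<close>
  define \<rho> where "\<rho> = (norm m + C) / \<kappa> + 1"
  have C0: "0 \<le> C" by (simp add: C_def)
  then have \<rho>1: "1 \<le> \<rho>" using \<kappa> by (simp add: \<rho>_def)
  have mlow: "- (norm m * norm w) \<le> m \<bullet> w" for w
    using Cauchy_Schwarz_ineq2[of m w] by linarith
  have "compact (q ` cball 0 \<rho>)"
    by (intro compact_continuous_image continuous_on_subset[OF q]) auto
  then obtain Q where Q: "\<And>w. norm w \<le> \<rho> \<Longrightarrow> \<bar>q w\<bar> \<le> Q"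
    using compact_imp_bounded bounded_iff by (metis imageI mem_cball_0 real_norm_def)
  have bd: "norm w \<le> \<rho> \<and> - (norm m * \<rho>) - b - Q \<le> t \<and> t \<le> m0 + Q" if "(w, t) \<in> K" for w t
  proof -
    have wt: "\<kappa> * (norm w)\<^sup>2 + m \<bullet> w - b \<le> t + q w" "t + q w \<le> m0"
      using that coercive by (auto simp: K_def)
    then have "\<kappa> * (norm w)\<^sup>2 \<le> norm m * norm w + C"
      using mlow[of w] by (simp add: C_def)
    moreover have "norm m * norm w + C < \<kappa> * (norm w)\<^sup>2" if "norm w > \<rho>"
    proof -
      have w1: "norm w > 1" using that \<rho>1 by simp
      have "(norm m + C) / \<kappa> < norm w" using that by (simp add: \<rho>_def)
      then have "norm m + C < \<kappa> * norm w" using \<kappa> by (simp add: pos_divide_less_eq mult.commute)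
      then have "(norm m + C) * norm w < \<kappa> * norm w * norm w"
        using w1 by (intro mult_strict_right_mono) auto
      moreover have "C * 1 \<le> C * norm w" using w1 C0 by (intro mult_left_mono) auto
      ultimately show ?thesis by (simp add: algebra_simps power2_eq_square)
    qed
    ultimately have w: "norm w \<le> \<rho>" by force
    have "0 \<le> \<kappa> * (norm w)\<^sup>2" using \<kappa> by simp
    moreover have "norm m * norm w \<le> norm m * \<rho>" using w by (intro mult_left_mono) auto
    ultimately show ?thesis using wt w mlow[of w] Q[OF w] by (auto simp: abs_le_iff)
  qed
  have "K \<subseteq> cball 0 \<rho> \<times> {- (norm m * \<rho>) - b - Q..m0 + Q}" using bd by auto
  moreover have "compact (cball (0::'a) \<rho> \<times> {- (norm m * \<rho>) - b - Q..m0 + Q})"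
    by (intro compact_Times) auto
  ultimately have "bounded K" using bounded_subset compact_imp_bounded by blast
  have cont: "continuous_on S (\<lambda>p::'a \<times> real. snd p + q (fst p))" for S
    by (intro continuous_intros continuous_on_compose2[OF q]) auto
  have "closed K"
    unfolding K_def by (intro closed_Int cl closed_Collect_le cont continuous_on_const)
  with \<open>bounded K\<close> have "compact K" by (simp add: compact_eq_bounded_closed)
  moreover have "K \<noteq> {}" using e0 by (auto simp: K_def m0_def)
  ultimately obtain p where p: "p \<in> K"
    "\<And>p'. p' \<in> K \<Longrightarrow> snd p + q (fst p) \<le> snd p' + q (fst p')"
    using continuous_attains_inf[OF _ _ cont] by metis
  have glob: "snd p + q (fst p) \<le> t + q w" if "(w, t) \<in> ereal_epigraph f" for w t
  proof (cases "t + q w \<le> m0")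
    case True
    then show ?thesis using p(2)[of "(w, t)"] that by (simp add: K_def)
  next
    case False
    then show ?thesis using p(1) by (simp add: K_def)
  qed
  have "(fst p, snd p) \<in> ereal_epigraph f" using p(1) by (simp add: K_def)
  then obtain a where a: "f (fst p) = ereal a" "a \<le> snd p" using epigraph_finite ninf by metis
  show ?thesis
  proof (rule that[OF a(1)])
    show "a + q (fst p) \<le> t + q w" if "(w, t) \<in> ereal_epigraph f" for w t
      using glob[OF that] a(2) by simp
  qed
qed

section \<open>Conjugates and their epigraphs\<close>

lemma epigraph_conjugate_iff:
  assumes "\<And>x. f x \<noteq> - \<infinity>"
  shows "(y, b) \<in> ereal_epigraph (convex_conjugate f) \<longleftrightarrow>
    (\<forall>x a. (x, a) \<in> ereal_epigraph f \<longrightarrow> x \<bullet> y - a \<le> b)"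
proof -
  have "(ereal (x \<bullet> y) - f x \<le> ereal b) \<longleftrightarrow> (\<forall>a. f x \<le> ereal a \<longrightarrow> x \<bullet> y - a \<le> b)" for x
    using assms[of x] by (cases "f x") (auto simp: algebra_simps)
  then show ?thesis
    by (auto simp: ereal_epigraph_def convex_conjugate_def SUP_le_iff)
qed

lemma conjugate_not_MInf:
  assumes "f x = ereal a" shows "convex_conjugate f y \<noteq> - \<infinity>"
proof -
  have "ereal (x \<bullet> y - a) \<le> convex_conjugate f y"
    unfolding convex_conjugate_def by (rule SUP_upper2[of x]) (auto simp: assms)
  then show ?thesis by auto
qed

lemma conjugate_at_subgradient:
  assumes f: "closed_proper_convex f" and s: "s \<in> subdifferential f x" and a: "f x = ereal a"
  shows "convex_conjugate f s = ereal (x \<bullet> s - a)"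
proof -
  have ninf: "\<And>x. f x \<noteq> - \<infinity>" using f by (simp add: closed_proper_convex_def)
  have "(s, x \<bullet> s - a) \<in> ereal_epigraph (convex_conjugate f)"
    using s by (fastforce simp: epigraph_conjugate_iff[of f, OF ninf] subdifferential_iff[of f, OF ninf a]
        algebra_simps inner_commute)
  moreover have "ereal (x \<bullet> s - a) \<le> convex_conjugate f s"
    unfolding convex_conjugate_def by (rule SUP_upper2[of x]) (auto simp: a)
  ultimately show ?thesis by (auto simp: ereal_epigraph_def)
qed

text \<open>An intersection of half-spaces with normals \<open>(x, - 1)\<close>, whence closedness
  and convexity.\<close>

lemma epigraph_conjugate_eq:
  assumes "\<And>x. f x \<noteq> - \<infinity>"
  shows "ereal_epigraph (convex_conjugate f) =
    (\<Inter>(x, a) \<in> ereal_epigraph f. {w. (x, - 1) \<bullet> w \<le> a})"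
  using epigraph_conjugate_iff[of f, OF assms] by (fastforce simp: algebra_simps)

lemma closed_convex_epigraph_conjugate:
  fixes f :: "'a::real_inner \<Rightarrow> ereal"
  assumes "\<And>x. f x \<noteq> - \<infinity>"
  shows "closed (ereal_epigraph (convex_conjugate f))" "convex (ereal_epigraph (convex_conjugate f))"
  unfolding epigraph_conjugate_eq[of f, OF assms]
  by (auto intro!: closed_INT convex_INT closed_halfspace_le convex_halfspace_le)

text \<open>Equality in Fenchel-Young, starting from the conjugate. Otherwise the point
  \<open>(x, x \<bullet> y - b)\<close> would be outside the closed convex epigraph of
  \<open>f\<close>, and either kind of separating hyperplane contradicts the subgradient
  inequality.\<close>

lemma subdifferential_conjugate:
  fixes f :: "'a::euclidean_space \<Rightarrow> ereal"
  assumes f: "closed_proper_convex f" and b: "convex_conjugate f y = ereal b"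
    and x: "x \<in> subdifferential (convex_conjugate f) y"
  shows "f x = ereal (x \<bullet> y - b)"
proof -
  have ninf: "\<And>x. f x \<noteq> - \<infinity>" and cl: "closed (ereal_epigraph f)" and cv: "convex (ereal_epigraph f)"
    using f by (auto simp: closed_proper_convex_def)
  obtain x0 a0 where x0: "f x0 = ereal a0" using proper_point[OF f] .
  have ninf': "\<And>y. convex_conjugate f y \<noteq> - \<infinity>" by (rule conjugate_not_MInf[of f, OF x0])
  have sub: "b + x \<bullet> (y' - y) \<le> b'"
    if "\<And>w t. (w, t) \<in> ereal_epigraph f \<Longrightarrow> w \<bullet> y' - t \<le> b'" for y' b'
  proof -
    have "(y', b') \<in> ereal_epigraph (convex_conjugate f)"
      using that by (auto simp: epigraph_conjugate_iff[of f, OF ninf])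
    then show ?thesis using x by (auto simp: subdifferential_iff[of "convex_conjugate f", OF ninf' b])
  qed
  have fy: "w \<bullet> y - t \<le> b" if "(w, t) \<in> ereal_epigraph f" for w t
    using epigraph_of_finite[of "convex_conjugate f", OF b] that
    by (auto simp: epigraph_conjugate_iff[of f, OF ninf])
  have "(x, x \<bullet> y - b) \<in> ereal_epigraph f"
  proof (rule ccontr)
    assume "\<not> ?thesis"
    then obtain n\<gamma> \<beta> where sep: "n\<gamma> \<bullet> (x, x \<bullet> y - b) < \<beta>"
      "\<forall>p\<in>ereal_epigraph f. \<beta> < n\<gamma> \<bullet> p"
      using separating_hyperplane_closed_point[OF cv cl] by metis
    obtain n \<gamma> where "n\<gamma> = (n, \<gamma>)" by fastforce
    with sep have s1: "n \<bullet> x + \<gamma> * (x \<bullet> y - b) < \<beta>"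
      and s2: "\<And>w t. (w, t) \<in> ereal_epigraph f \<Longrightarrow> \<beta> < n \<bullet> w + \<gamma> * t"
      by auto
    have "\<gamma> \<ge> 0"
    proof (rule ccontr)
      assume \<gamma>: "\<not> \<gamma> \<ge> 0"
      \<comment> \<open>The epigraph is unbounded upwards over \<open>x0\<close>; with negative
        \<open>\<gamma>\<close> a point this high falls on the wrong side.\<close>
      define t where "t = max a0 ((\<beta> - n \<bullet> x0) / \<gamma>)"
      have "(x0, t) \<in> ereal_epigraph f" by (simp add: ereal_epigraph_def x0 t_def)
      from s2[OF this] have "(\<beta> - n \<bullet> x0) / \<gamma> > t" using \<gamma> by (simp add: field_simps)
      then show False by (simp add: t_def)
    qed
    then consider "\<gamma> > 0" | "\<gamma> = 0" by linarith
    then show False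
    proof cases
      case 1
      \<comment> \<open>A nonvertical hyperplane is an affine minorant of \<open>f\<close>; its
        slope is \<open>y'\<close>, and the conjugate there is at most
        \<open>- \<beta> / \<gamma>\<close>.\<close>
      define y' where "y' = (- 1 / \<gamma>) *\<^sub>R n"
      have "b + x \<bullet> (y' - y) \<le> - \<beta> / \<gamma>"
      proof (rule sub)
        fix w t assume "(w, t) \<in> ereal_epigraph f"
        from s2[OF this] have "\<beta> / \<gamma> < (n \<bullet> w + \<gamma> * t) / \<gamma>"
          using 1 by (rule divide_strict_right_mono)
        then show "w \<bullet> y' - t \<le> - \<beta> / \<gamma>"
          using 1 by (simp add: y'_def add_divide_distrib inner_commute)
      qed
      moreover have "(n \<bullet> x + \<gamma> * (x \<bullet> y - b)) / \<gamma> < \<beta> / \<gamma>"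
        using s1 1 by (rule divide_strict_right_mono)
      ultimately show False
        using 1 by (simp add: y'_def add_divide_distrib inner_commute inner_diff_right)
    next
      case 2
      \<comment> \<open>A vertical hyperplane gives \<open>\<beta> < n \<bullet> w\<close> on the
        whole domain of \<open>f\<close>, so moving from \<open>y\<close> to \<open>y - n\<close>
        bounds the conjugate by \<open>b - \<beta>\<close>.\<close>
      have "b + x \<bullet> ((y - n) - y) \<le> b - \<beta>"
      proof (rule sub)
        fix w t assume "(w, t) \<in> ereal_epigraph f"
        from s2[OF this] fy[OF this] show "w \<bullet> (y - n) - t \<le> b - \<beta>"
          using 2 by (simp add: inner_diff_right inner_commute)
      qed
      with s1 2 show False by (simp add: inner_commute)
    qed
  qed
  then obtain a where a: "f x = ereal a" "a \<le> x \<bullet> y - b" using epigraph_finite ninf by metis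
  moreover have "x \<bullet> y - a \<le> b" by (rule fy[OF epigraph_of_finite[of f, OF a(1)]])
  ultimately show ?thesis by simp
qed

text \<open>Minimizing \<open>f\<close> minus the linear functional \<open>y\<close> plus
  \<open>\<delta> / 2\<close> times the squared norm gives a minimizer \<open>x\<close> with
  subgradient \<open>y - \<delta> *\<^sub>R x\<close>, close to \<open>y\<close> for small
  \<open>\<delta>\<close>.\<close>

lemma conjugate_domain_subset_closure:
  fixes f :: "'a::euclidean_space \<Rightarrow> ereal"
  assumes f: "closed_proper_convex f"
  shows "fst ` ereal_epigraph (convex_conjugate f) \<subseteq> closure (\<Union>x. subdifferential f x)"
proof
  fix y assume "y \<in> fst ` ereal_epigraph (convex_conjugate f)"
  then obtain b where yb: "(y, b) \<in> ereal_epigraph (convex_conjugate f)" by force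
  have ninf: "\<And>x. f x \<noteq> - \<infinity>" using f by (simp add: closed_proper_convex_def)
  obtain x0 a0 where x0: "f x0 = ereal a0" using proper_point[OF f] .
  have fy: "y \<bullet> w - b \<le> t" if "(w, t) \<in> ereal_epigraph f" for w t
    using yb that by (fastforce simp: epigraph_conjugate_iff[of f, OF ninf] inner_commute)
  show "y \<in> closure (\<Union>x. subdifferential f x)"
    unfolding closure_approachable
  proof (intro allI impI)
    fix \<epsilon> :: real assume \<epsilon>: "\<epsilon> > 0"
    \<comment> \<open>The Fenchel-Young gap at \<open>x0\<close>. Comparison with \<open>x0\<close>
      will bound the quadratic term at the minimizer by \<open>D\<close>, and
      \<open>\<delta>\<close> is set so that
      \<open>2 * D * \<delta> \<le> \<epsilon>\<^sup>2\<close>.\<close>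
    define C where "C = a0 - y \<bullet> x0 + b"
    have "C \<ge> 0" using fy[OF epigraph_of_finite[of f, OF x0]] by (simp add: C_def)
    define D where "D = C + (norm x0)\<^sup>2 / 2 + 1"
    have D: "D > 0" using \<open>C \<ge> 0\<close> by (simp add: D_def add_nonneg_pos)
    define \<delta> where "\<delta> = min 1 (\<epsilon>\<^sup>2 / (2 * D))"
    have \<delta>: "\<delta> > 0" "\<delta> \<le> 1" "2 * D * \<delta> \<le> \<epsilon>\<^sup>2"
      using \<epsilon> D by (auto simp: \<delta>_def min_def field_simps)
    define q where "q w = \<delta> / 2 * (norm w)\<^sup>2 - y \<bullet> w" for w :: 'a
    obtain x a where x: "f x = ereal a"
      and min: "\<And>w t. (w, t) \<in> ereal_epigraph f \<Longrightarrow> a + q x \<le> t + q w"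
    proof (rule coercive_minimizer[OF f, of q "\<delta> / 2" 0 b])
      show "continuous_on UNIV q" unfolding q_def by (intro continuous_intros)
      show "\<delta> / 2 * (norm w)\<^sup>2 + 0 \<bullet> w - b \<le> t + q w" if "(w, t) \<in> ereal_epigraph f" for w t
        using fy[OF that] by (simp add: q_def)
    qed (use \<delta> in auto)
    have "- (\<delta> *\<^sub>R x - y) \<in> subdifferential f x"
    proof (rule minimizer_subgradient[of f x a q, OF f x min])
      show "q (x + \<theta> *\<^sub>R w) = q x + \<theta> * ((\<delta> *\<^sub>R x - y) \<bullet> w) + \<theta>\<^sup>2 * (\<delta> / 2 * (norm w)\<^sup>2)" for \<theta> w
      proof -
        have "(norm (x + \<theta> *\<^sub>R w))\<^sup>2 = (norm x)\<^sup>2 + 2 * \<theta> * (x \<bullet> w) + \<theta>\<^sup>2 * (norm w)\<^sup>2"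
          unfolding power2_norm_eq_inner
          by (simp add: inner_add inner_commute[of w x] algebra_simps power2_eq_square)
        then show ?thesis by (simp add: q_def algebra_simps)
      qed
    qed
    moreover have "dist (- (\<delta> *\<^sub>R x - y)) y < \<epsilon>"
    proof -
      have "\<delta> / 2 * (norm x0)\<^sup>2 \<le> 1 / 2 * (norm x0)\<^sup>2"
        using \<delta> by (intro mult_right_mono) auto
      then have "\<delta> / 2 * (norm x)\<^sup>2 < D"
        using min[OF epigraph_of_finite[of f, OF x0]] fy[OF epigraph_of_finite[of f, OF x]]
        by (simp add: q_def D_def C_def)
      then have "(norm (\<delta> *\<^sub>R x))\<^sup>2 < 2 * D * \<delta>"
        using \<delta> by (simp add: power_mult_distrib power2_eq_square mult_ac)
      also have "\<dots> \<le> \<epsilon>\<^sup>2" by (rule \<delta>)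
      finally have "norm (\<delta> *\<^sub>R x) < \<epsilon>"
        using \<epsilon> by (intro power2_less_imp_less[of _ \<epsilon>]) auto
      then show ?thesis by (simp add: dist_norm)
    qed
    ultimately show "\<exists>y'\<in>\<Union>x. subdifferential f x. dist y' y < \<epsilon>" by blast
  qed
qed


section \<open>Composition of the conjugate with the transpose\<close>

declare transpose_matrix_vector [simp del]

lemma transpose_inner: "x \<bullet> (transpose M *v q) = (M *v x) \<bullet> q" for M :: "real ^ 'n ^ 'm"
  by (metis dot_lmul_matrix inner_commute transpose_matrix_vector)

text \<open>The epigraph is the preimage of that of the conjugate under the linear map
  \<open>L\<close>.\<close>

lemma closed_proper_convex_conjugate_comp:
  fixes f :: "real ^ 'n \<Rightarrow> ereal" and M :: "real ^ 'n ^ 'm"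
  assumes f: "closed_proper_convex f" and fin: "conjugate_comp f M q0 \<noteq> \<infinity>"
  shows "closed_proper_convex (conjugate_comp f M)"
proof -
  have ninf: "\<And>x. f x \<noteq> - \<infinity>" using f by (simp add: closed_proper_convex_def)
  obtain x0 a0 where x0: "f x0 = ereal a0" using proper_point[OF f] .
  define L where "L = (\<lambda>(q :: real ^ 'm, b :: real). (- (transpose M *v q), b))"
  have L: "linear L"
    by (rule linearI) (auto simp: L_def algebra_simps matrix_vector_right_distrib
        matrix_vector_mult_scaleR)
  have eq: "ereal_epigraph (conjugate_comp f M) = L -` ereal_epigraph (convex_conjugate f)"
    by (auto simp: L_def ereal_epigraph_def conjugate_comp_def)
  have "closed (ereal_epigraph (conjugate_comp f M))"
    unfolding eq using closed_convex_epigraph_conjugate(1)[of f, OF ninf] L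
    by (intro closed_vimage) (auto intro: linear_continuous_on simp: linear_conv_bounded_linear)
  moreover have "convex (ereal_epigraph (conjugate_comp f M))"
    unfolding eq using closed_convex_epigraph_conjugate(2)[of f, OF ninf] L
    by (intro convex_linear_vimage)
  moreover have "conjugate_comp f M q \<noteq> - \<infinity>" for q
    unfolding conjugate_comp_def by (rule conjugate_not_MInf[of f, OF x0])
  ultimately show ?thesis using fin by (auto simp: closed_proper_convex_def)
qed

text \<open>The easy inclusion of the chain rule: the point \<open>x\<close> yields an affine
  minorant of the composition that touches it at \<open>q\<close>.\<close>

lemma subdifferential_conjugate_comp:
  fixes f :: "real ^ 'n \<Rightarrow> ereal" and M :: "real ^ 'n ^ 'm"
  assumes f: "closed_proper_convex f" and s: "- (transpose M *v q) \<in> subdifferential f x"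
  shows "- (M *v x) \<in> subdifferential (conjugate_comp f M) q"
proof -
  obtain a where a: "f x = ereal a" using subdifferential_finite[OF f s] .
  have h: "conjugate_comp f M q = ereal (- ((M *v x) \<bullet> q) - a)"
    using conjugate_at_subgradient[OF f s a]
    by (simp add: conjugate_comp_def transpose_inner)
  have "ereal (- ((M *v x) \<bullet> w) - a) \<le> conjugate_comp f M w" for w
    unfolding conjugate_comp_def convex_conjugate_def
    by (rule SUP_upper2[of x]) (auto simp: a transpose_inner)
  then show ?thesis
    by (simp add: subdifferential_def h algebra_simps)
qed

text \<open>The range of the subdifferential lies in the domain of the conjugate and is dense there,
  so their affine hulls agree. This moves the regularity condition to a set known to be
  convex.\<close>

lemma rel_interior_subdifferential_range:
  fixes f :: "'a::euclidean_space \<Rightarrow> ereal"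
  assumes f: "closed_proper_convex f"
  shows "rel_interior (\<Union>x. subdifferential f x) \<subseteq> rel_interior (fst ` ereal_epigraph (convex_conjugate f))"
    (is "rel_interior ?R \<subseteq> rel_interior ?C")
proof (rule subset_rel_interior)
  show sub: "?R \<subseteq> ?C"
  proof
    fix s assume "s \<in> ?R"
    then obtain x where s: "s \<in> subdifferential f x" by blast
    obtain a where a: "f x = ereal a" using subdifferential_finite[OF f s] .
    have "(s, x \<bullet> s - a) \<in> ereal_epigraph (convex_conjugate f)"
      using conjugate_at_subgradient[OF f s a] by (simp add: ereal_epigraph_def)
    then show "s \<in> ?C" by force
  qed
  have "affine hull ?C \<subseteq> affine hull closure ?R"
    by (rule hull_mono[OF conjugate_domain_subset_closure[OF f]])
  then show "affine hull ?R = affine hull ?C"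
    using hull_mono[OF sub] by (simp add: closure_same_affine_hull subset_antisym)
qed

lemma bounded_below_linear_eq_0:
  fixes g :: "'a::real_inner"
  assumes "\<And>p. c \<le> g \<bullet> p" shows "g = 0"
proof (rule ccontr)
  assume "g \<noteq> 0"
  then have "g \<bullet> (((c - 1) / (g \<bullet> g)) *\<^sub>R g) = c - 1" by simp
  with assms[of "((c - 1) / (g \<bullet> g)) *\<^sub>R g"] show False by simp
qed

text \<open>The hard inclusion of the chain rule, together with the value of \<open>f\<close> at the
  point found. A hyperplane supporting \<open>K\<close> at its lowest point over 0 is nonvertical by
  the regularity condition, and its normalized slope is the required \<open>x\<close>.\<close>

lemma conjugate_comp_chain_rule:
  fixes f :: "real ^ 'n \<Rightarrow> ereal" and M :: "real ^ 'n ^ 'm"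
  assumes f: "closed_proper_convex f"
    and ri: "rel_interior (\<Union>y. subdifferential f y) \<inter> range ((*v) (transpose M)) \<noteq> {}"
    and s: "- zs \<in> subdifferential (conjugate_comp f M) ps"
    and \<beta>: "conjugate_comp f M ps = ereal \<beta>"
  obtains x where "M *v x = zs" "f x = ereal (- (zs \<bullet> ps) - \<beta>)"
proof -
  have ninf: "\<And>x. f x \<noteq> - \<infinity>" using f by (simp add: closed_proper_convex_def)
  define E where "E = ereal_epigraph (convex_conjugate f)"
  define ys where "ys = - (transpose M *v ps)"
  have cE: "convex E" unfolding E_def by (rule closed_convex_epigraph_conjugate(2)[of f, OF ninf])
  have conj\<beta>: "convex_conjugate f ys = ereal \<beta>" using \<beta> by (simp add: conjugate_comp_def ys_def)
  have h: "closed_proper_convex (conjugate_comp f M)"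
    using closed_proper_convex_conjugate_comp[OF f] \<beta> by (metis PInfty_neq_ereal(1))
  have hninf: "\<And>p. conjugate_comp f M p \<noteq> - \<infinity>" using h by (simp add: closed_proper_convex_def)
  have below: "\<beta> + zs \<bullet> ps \<le> b + zs \<bullet> p" if "(- (transpose M *v p), b) \<in> E" for p b
  proof -
    have "(p, b) \<in> ereal_epigraph (conjugate_comp f M)"
      using that by (simp add: E_def ereal_epigraph_def conjugate_comp_def)
    then have "\<beta> + (- zs) \<bullet> (p - ps) \<le> b"
      using s subdifferential_iff[of "conjugate_comp f M", OF hninf \<beta>] by blast
    then show ?thesis by (simp add: inner_diff_right)
  qed
  \<comment> \<open>\<open>K\<close> will be the sum of \<open>E\<close> and the subspace of all
    \<open>(transpose M *v p, zs \<bullet> p)\<close>. Its heights over 0 are those above some value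
    of the composition at \<open>p\<close> plus \<open>zs \<bullet> p\<close>, so the subgradient
    \<open>- zs\<close> makes \<open>\<sigma>\<close> the lowest.\<close>
  define L where "L = (\<lambda>((y, t), p :: real ^ 'm). (y + transpose M *v p, t + zs \<bullet> p))"
  have L: "linear L"
    by (rule linearI) (auto simp: L_def algebra_simps matrix_vector_right_distrib
        matrix_vector_mult_scaleR inner_add_right)
  define K where "K = L ` (E \<times> UNIV)"
  have cK: "convex K"
    unfolding K_def by (intro convex_linear_image L convex_Times cE convex_UNIV)
  have KI: "(y + transpose M *v p, t + zs \<bullet> p) \<in> K" if "(y, t) \<in> E" for y t p
    unfolding K_def L_def using that by force
  define \<sigma> where "\<sigma> = \<beta> + zs \<bullet> ps"
  have yE: "(ys, \<beta>) \<in> E" "(ys, \<beta> + 1) \<in> E"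
    by (simp_all add: E_def ereal_epigraph_def conj\<beta>)
  have K0: "(0, \<sigma>) \<in> K" "(0, \<sigma> + 1) \<in> K"
    using KI[OF yE(1), of ps] KI[OF yE(2), of ps] by (simp_all add: ys_def \<sigma>_def add_ac)
  have Klow: "\<sigma> \<le> r" if "(0, r) \<in> K" for r
  proof -
    obtain y t p where "(y, t) \<in> E" "y + transpose M *v p = 0" "r = t + zs \<bullet> p"
      using \<open>(0, r) \<in> K\<close> by (auto simp: K_def L_def)
    moreover from this have "y = - (transpose M *v p)" by (simp add: eq_neg_iff_add_eq_0)
    ultimately show ?thesis using below by (simp add: \<sigma>_def)
  qed
  \<comment> \<open>From a relative interior point, the segment coming down from
    \<open>(0, \<sigma> + 1)\<close> could be prolonged below height
    \<open>\<sigma>\<close>.\<close>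
  have "(0, \<sigma>) \<notin> rel_interior K"
  proof
    assume "(0, \<sigma>) \<in> rel_interior K"
    then obtain e where e: "e > 1" "(1 - e) *\<^sub>R (0, \<sigma> + 1) + e *\<^sub>R (0, \<sigma>) \<in> K"
      using convex_rel_interior_iff[OF cK] K0 by (metis empty_iff)
    then have "(0, (1 - e) * (\<sigma> + 1) + e * \<sigma>) \<in> K" by simp
    from Klow[OF this] e(1) show False by (simp add: algebra_simps)
  qed
  from supporting_hyperplane_rel_boundary[OF cK K0(1) this]
  obtain e\<theta> where "e\<theta> \<noteq> 0" "\<And>w. w \<in> K \<Longrightarrow> e\<theta> \<bullet> (0, \<sigma>) \<le> e\<theta> \<bullet> w"
    "\<And>w. w \<in> rel_interior K \<Longrightarrow> e\<theta> \<bullet> (0, \<sigma>) < e\<theta> \<bullet> w" by metis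
  moreover obtain e \<theta> where "e\<theta> = (e, \<theta>)" by fastforce
  ultimately have sup: "\<And>y t. (y, t) \<in> K \<Longrightarrow> \<theta> * \<sigma> \<le> e \<bullet> y + \<theta> * t"
    and strict: "\<And>y t. (y, t) \<in> rel_interior K \<Longrightarrow> \<theta> * \<sigma> < e \<bullet> y + \<theta> * t"
    by force+
  \<comment> \<open>The vector \<open>p\<close> is arbitrary, so its coefficient must vanish; after
    division by \<open>\<theta>\<close> this becomes \<open>M *v x = zs\<close>.\<close>
  have "\<theta> * \<sigma> - e \<bullet> ys - \<theta> * \<beta> \<le> (M *v e + \<theta> *\<^sub>R zs) \<bullet> p" for p
    using sup[OF KI[OF yE(1), of p]] by (simp add: inner_add transpose_inner algebra_simps)
  then have Me: "M *v e + \<theta> *\<^sub>R zs = 0" by (rule bounded_below_linear_eq_0)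
  have "\<theta> \<ge> 0" using sup[OF K0(2)] by (simp add: algebra_simps)
  moreover have "\<theta> \<noteq> 0"
    \<comment> \<open>A vertical hyperplane would be constant on the domain of the conjugate, because it is
      minimal there at the relative interior point \<open>a0\<close>; that contradicts properness.\<close>
  proof
    assume \<theta>: "\<theta> = 0"
    with Me have Me0: "M *v e = 0" by simp
    obtain a0 w where a0: "a0 \<in> rel_interior (fst ` E)" "a0 = transpose M *v w"
      using ri rel_interior_subdifferential_range[OF f] by (auto simp: E_def)
    have ea0: "e \<bullet> a0 = 0" by (simp add: a0(2) transpose_inner Me0)
    have cC: "convex (fst ` E)" by (rule convex_linear_image[OF linear_fst cE])
    have nonneg: "0 \<le> e \<bullet> y" if y: "y \<in> fst ` E" for y
    proof -
      obtain t where "(y, t) \<in> E" using y by force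
      from sup[OF KI[OF this, of 0]] \<theta> show ?thesis by simp
    qed
    have zero: "e \<bullet> y = 0" if y: "y \<in> fst ` E" for y
    proof -
      \<comment> \<open>Prolongs the segment from \<open>y\<close> past \<open>a0\<close>; the
        weight \<open>1 - r\<close> of \<open>y\<close> is negative.\<close>
      obtain r where r: "r > 1" "(1 - r) *\<^sub>R y + r *\<^sub>R a0 \<in> fst ` E"
        using convex_rel_interior_iff[OF cC] a0(1) y by (metis empty_iff)
      from nonneg[OF r(2)] have "0 \<le> (1 - r) * (e \<bullet> y)" by (simp add: inner_add_right ea0)
      with r(1) nonneg[OF y] show ?thesis by (simp add: zero_le_mult_iff)
    qed
    obtain w t where wt: "(w, t) \<in> rel_interior K"
      using rel_interior_eq_empty[OF cK] K0 by fastforce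
    then obtain y t' p where "(y, t') \<in> E" "w = y + transpose M *v p"
      using rel_interior_subset[of K] by (auto simp: K_def L_def)
    then have "e \<bullet> w = 0" using zero[of y] by (force simp: inner_add_right transpose_inner Me0)
    with strict[OF wt] \<theta> show False by simp
  qed
  ultimately have \<theta>: "\<theta> > 0" by simp
  define x where "x = (- 1 / \<theta>) *\<^sub>R e"
  have e: "e = - \<theta> *\<^sub>R x" using \<theta> by (simp add: x_def)
  have "M *v e = (- \<theta>) *\<^sub>R (M *v x)"
    unfolding e by (rule matrix_vector_mult_scaleR)
  then have "\<theta> *\<^sub>R (zs - M *v x) = 0" using Me by (simp add: algebra_simps)
  then have Mx: "M *v x = zs" using \<theta> by simp
  have "x \<in> subdifferential (convex_conjugate f) ys"
  proof -
    obtain x0 a0 where x0: "f x0 = ereal a0" using proper_point[OF f] .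
    have ninf': "\<And>y. convex_conjugate f y \<noteq> - \<infinity>" by (rule conjugate_not_MInf[of f, OF x0])
    have "\<beta> + x \<bullet> (y - ys) \<le> t" if "(y, t) \<in> E" for y t
    proof -
      have "\<theta> * (\<beta> + x \<bullet> (y - ys)) \<le> \<theta> * t"
        using sup[OF KI[OF that, of ps]]
        by (simp add: e ys_def \<sigma>_def inner_add_right algebra_simps)
      then show ?thesis using \<theta> by simp
    qed
    then show ?thesis
      by (auto simp: subdifferential_iff[of "convex_conjugate f", OF ninf' conj\<beta>] E_def)
  qed
  from subdifferential_conjugate[OF f conj\<beta> this]
  have "f x = ereal (- (zs \<bullet> ps) - \<beta>)" by (simp add: ys_def transpose_inner Mx)
  with Mx that show ?thesis by blast
qed

section \<open>The iteration for the dual problem\<close>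

context spd_form
begin

lemma decomposition_unique:
  assumes "subspace V" "a \<in> V" "b \<in> V" "\<And>w. w \<in> V \<Longrightarrow> form w (r - a) = 0" "\<And>w. w \<in> V \<Longrightarrow> form w (r - b) = 0"
  shows "a = b"
proof (rule ccontr)
  assume "a \<noteq> b"
  have V: "a - b \<in> V" using assms(1-3) by (simp add: subspace_diff)
  have "form (a - b) (a - b) = form (a - b) (r - b) - form (a - b) (r - a)"
    by (simp add: form_diff_right)
  also have "\<dots> = 0" using assms(4,5) V by simp
  finally show False using pos[of "a - b"] \<open>a \<noteq> b\<close> by (simp add: form_def)
qed

text \<open>A dimension count: \<open>A\<close> maps the form-complement \<open>T\<close>
  bijectively onto the Euclidean complement of \<open>V\<close>, and \<open>V \<inter> T\<close> is
  trivial by positivity. Uniqueness of the decomposition makes \<open>P\<close> linear.\<close>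

lemma projection_exists:
  assumes V: "subspace V"
  obtains P where "linear P" "\<And>r. P r \<in> V" "\<And>r w. w \<in> V \<Longrightarrow> form w (r - P r) = 0"
proof -
  have "\<exists>a\<in>V. \<forall>w\<in>V. form w (r - a) = 0" for r
  proof -
    define T where "T = {a. \<forall>w\<in>V. form w a = 0}"
    have T: "subspace T"
      by (auto simp: T_def subspace_def form_def inner_add_right linear_0[OF lin] linear_add[OF lin]
          linear_scale[OF lin])
    have "A ` T = {a \<in> UNIV. \<forall>w\<in>V. orthogonal w a}"
    proof (intro subset_antisym subsetI)
      fix a assume a: "a \<in> {a \<in> UNIV. \<forall>w\<in>V. orthogonal w a}"
      obtain b where "a = A b" using bij_is_surj[OF bij_A] by (rule surjE)
      with a show "a \<in> A ` T" by (auto simp: T_def form_def orthogonal_def)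
    qed (auto simp: T_def form_def orthogonal_def)
    moreover have "dim (A ` T) = dim T"
      by (rule dim_image_eq[OF lin]) (use bij_A in \<open>auto simp: bij_def inj_on_def\<close>)
    ultimately have "dim T + dim V = DIM('a)"
      using dim_subspace_orthogonal_to_vectors[OF V subspace_UNIV] by simp
    moreover have "V \<inter> T = {0}"
    proof -
      have "a = 0" if "a \<in> V" "a \<in> T" for a
        using that pos[of a] by (force simp: T_def form_def)
      then show ?thesis using subspace_0[OF V] subspace_0[OF T] by auto
    qed
    ultimately have "dim {x + y |x y. x \<in> V \<and> y \<in> T} = DIM('a)"
      using dim_sums_Int[OF V T] by simp
    then have "span {x + y |x y. x \<in> V \<and> y \<in> T} = UNIV" by (simp add: dim_eq_full)
    then have "{x + y |x y. x \<in> V \<and> y \<in> T} = UNIV"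
      using span_eq_iff[THEN iffD2, OF subspace_sums[OF V T]] by simp
    then obtain a b where "a \<in> V" "b \<in> T" "r = a + b" by blast
    then show ?thesis by (intro bexI[of _ a]) (auto simp: T_def)
  qed
  then obtain P where P: "\<And>r. P r \<in> V" "\<And>r w. w \<in> V \<Longrightarrow> form w (r - P r) = 0" by metis
  have "linear P"
  proof (rule linearI)
    show "P (a + b) = P a + P b" for a b
    proof (rule decomposition_unique[OF V _ _ P(2)])
      fix w assume "w \<in> V"
      then have "form w (a - P a) + form w (b - P b) = 0" using P(2) by simp
      then show "form w (a + b - (P a + P b)) = 0" by (simp add: form_bilinear)
    qed (use P(1) V in \<open>auto intro: subspace_add\<close>)
    show "P (t *\<^sub>R a) = t *\<^sub>R P a" for t a
    proof (rule decomposition_unique[OF V _ _ P(2)])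
      fix w assume "w \<in> V"
      then have "t * form w (a - P a) = 0" using P(2) by simp
      then show "form w (t *\<^sub>R a - t *\<^sub>R P a) = 0" by (simp add: form_bilinear algebra_simps)
    qed (use P(1) V in \<open>auto intro: subspace_scale\<close>)
  qed
  with P that show ?thesis by blast
qed

lemma continuous_on_form:
  fixes F G :: "'b::euclidean_space \<Rightarrow> 'a"
  assumes "linear F" "linear G" shows "continuous_on S (\<lambda>x. form (F x) (G x))"
proof -
  have "linear (\<lambda>x. A (G x))" using linear_compose[OF assms(2) lin] by (simp add: o_def)
  from this[THEN linear_conv_bounded_linear[THEN iffD1], THEN linear_continuous_on]
    assms(1)[THEN linear_conv_bounded_linear[THEN iffD1], THEN linear_continuous_on]
  show ?thesis unfolding form_def by (intro continuous_on_inner)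
qed

text \<open>The inclusion is the optimality condition for minimizing \<open>h\<close> plus a
  positive definite quadratic; the affine minorant of \<open>h\<close> makes the sum
  coercive.\<close>

lemma regularized_solution:
  assumes h: "closed_proper_convex h" and V: "subspace V"
    and minorant: "\<And>w t. (w, t) \<in> ereal_epigraph h \<Longrightarrow> m \<bullet> w - b \<le> t"
    and \<epsilon>: "0 < \<epsilon>"
  shows "\<exists>z\<in>V. \<exists>u. (\<forall>w\<in>V. form w u = 0) \<and>
    - (z + \<epsilon> *\<^sub>R (z + u)) \<in> subdifferential h (A (u + \<epsilon> *\<^sub>R (z + u)))"
proof -
  obtain P where P: "linear P" "\<And>r. P r \<in> V" "\<And>r w. w \<in> V \<Longrightarrow> form w (r - P r) = 0"
    using projection_exists[OF V] by blast
  define Q where "Q r = r - P r" for r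
  have Q: "linear Q" unfolding Q_def[abs_def] by (intro linear_compose_sub linear_ident P(1))
  have PQ: "form (P a) (Q b) = 0" "form (Q b) (P a) = 0" for a b
    using P(2,3) form_commute[of "P a" "Q b"] by (auto simp: Q_def)
  define B where "B = inv A"
  have AB: "A (B q) = q" "B (A q) = q" for q by (simp_all add: B_def A_inv)
  have B: "linear B" unfolding B_def by (rule linear_inv)
  \<comment> \<open>Weights chosen so that \<open>r = u + \<epsilon> (z + u)\<close> splits as \<open>P r = \<epsilon> z\<close>, \<open>Q r = (1 + \<epsilon>) u\<close> and
    \<open>z + \<epsilon> (z + u) = \<alpha> P r + \<beta> Q r\<close>.\<close>
  define \<alpha> \<beta> where "\<alpha> = (1 + \<epsilon>) / \<epsilon>" and "\<beta> = \<epsilon> / (1 + \<epsilon>)"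
  have \<alpha>\<beta>: "0 < \<beta>" "\<beta> \<le> \<alpha>"
    using \<epsilon> by (auto simp: \<alpha>_def \<beta>_def field_simps)
  define q where "q w = (\<alpha> * form (P (B w)) (P (B w)) + \<beta> * form (Q (B w)) (Q (B w))) / 2" for w
  have PB: "linear (\<lambda>w. P (B w))" "linear (\<lambda>w. Q (B w))"
    using linear_compose[OF B P(1)] linear_compose[OF B Q] by (simp_all add: o_def)
  have cont: "continuous_on UNIV q"
    unfolding q_def by (intro continuous_intros continuous_on_form PB) auto
  obtain K where K: "K > 0" "\<And>a. norm a \<le> K * nrm a" using norm_le_nrm by auto
  obtain L where L: "L > 0" "\<And>a. norm (A a) \<le> L * norm a"
    using linear_bounded_pos[OF lin] by auto
  \<comment> \<open>From \<open>norm w \<le> L * K * nrm (B w)\<close> and the smaller weight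
    \<open>\<beta>\<close>, halved as in \<open>q\<close>.\<close>
  define \<kappa> where "\<kappa> = \<beta> / (2 * (L * K)\<^sup>2)"
  have qlow: "\<kappa> * (norm w)\<^sup>2 \<le> q w" for w
  proof -
    have "norm w \<le> L * norm (B w)" using L(2)[of "B w"] by (simp add: AB)
    also have "\<dots> \<le> L * (K * nrm (B w))" using K(2) L(1) by (intro mult_left_mono) auto
    finally have "(norm w)\<^sup>2 \<le> (L * K * nrm (B w))\<^sup>2" by (intro power_mono) (auto simp: mult_ac)
    also have "\<dots> = (L * K)\<^sup>2 * form (B w) (B w)" by (simp add: power_mult_distrib nrm_sq)
    finally have "\<kappa> * (norm w)\<^sup>2 \<le> \<kappa> * ((L * K)\<^sup>2 * form (B w) (B w))"
      using \<alpha>\<beta> by (intro mult_left_mono) (auto simp: \<kappa>_def)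
    also have "\<dots> = \<beta> / 2 * form (B w) (B w)" using K(1) L(1) by (simp add: \<kappa>_def)
    also have "form (B w) (B w) = form (P (B w) + Q (B w)) (P (B w) + Q (B w))" by (simp add: Q_def)
    also have "\<dots> = form (P (B w)) (P (B w)) + form (Q (B w)) (Q (B w))"
      unfolding form_add_left form_add_right by (simp add: PQ)
    also have "\<beta> / 2 * \<dots> \<le> q w"
      using mult_right_mono[OF \<alpha>\<beta>(2) form_nonneg[of "P (B w)"]] by (simp add: q_def algebra_simps)
    finally show ?thesis .
  qed
  obtain x a where x: "h x = ereal a"
    and min: "\<And>w t. (w, t) \<in> ereal_epigraph h \<Longrightarrow> a + q x \<le> t + q w"
  proof (rule coercive_minimizer[OF h cont, of \<kappa> m b])
    show "\<kappa> * (norm w)\<^sup>2 + m \<bullet> w - b \<le> t + q w" if "(w, t) \<in> ereal_epigraph h" for w t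
      using minorant[OF that] qlow[of w] by simp
    show "0 < \<kappa>" using \<alpha>\<beta> K(1) L(1) by (simp add: \<kappa>_def)
  qed auto
  define r where "r = B x"
  define y where "y = \<alpha> *\<^sub>R P r + \<beta> *\<^sub>R Q r"
  have "- y \<in> subdifferential h x"
  proof (rule minimizer_subgradient[of h x a q, OF h x min])
    fix w :: 'a and \<theta> :: real
    have "y \<bullet> w = form y (B w)" by (simp add: form_def AB)
    also have "\<dots> = form y (P (B w) + Q (B w))" by (simp add: Q_def)
    also have "\<dots> = \<alpha> * form (P r) (P (B w)) + \<beta> * form (Q r) (Q (B w))"
      unfolding y_def form_bilinear by (simp add: PQ)
    finally have yw: "y \<bullet> w = \<alpha> * form (P r) (P (B w)) + \<beta> * form (Q r) (Q (B w))" .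
    show "q (x + \<theta> *\<^sub>R w) = q x + \<theta> * (y \<bullet> w) + \<theta>\<^sup>2 * q w"
      unfolding yw q_def r_def linear_add[OF PB(1)] linear_add[OF PB(2)] linear_scale[OF PB(1)]
        linear_scale[OF PB(2)] form_quadratic
      by (simp add: algebra_simps add_divide_distrib)
  qed
  moreover define z u where "z = (1 / \<epsilon>) *\<^sub>R P r" and "u = (1 / (1 + \<epsilon>)) *\<^sub>R Q r"
  have "u + \<epsilon> *\<^sub>R (z + u) = (1 + \<epsilon>) *\<^sub>R u + \<epsilon> *\<^sub>R z" by (simp add: algebra_simps)
  then have "u + \<epsilon> *\<^sub>R (z + u) = r" using \<epsilon> by (simp add: z_def u_def Q_def)
  moreover have "z + \<epsilon> *\<^sub>R (z + u) = (1 + \<epsilon>) *\<^sub>R z + \<epsilon> *\<^sub>R u" by (simp add: algebra_simps)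
  then have "z + \<epsilon> *\<^sub>R (z + u) = y" using \<epsilon> by (simp add: z_def u_def y_def \<alpha>_def \<beta>_def)
  ultimately have "- (z + \<epsilon> *\<^sub>R (z + u)) \<in> subdifferential h (A (u + \<epsilon> *\<^sub>R (z + u)))"
    by (simp add: r_def AB)
  moreover have "z \<in> V" using P(2) V by (simp add: z_def subspace_scale)
  moreover have "\<forall>w\<in>V. form w u = 0" using P(3) by (simp add: u_def Q_def form_scaleR_right)
  ultimately show ?thesis by (intro bexI[of _ z] exI[of _ u] conjI)
qed

end

section \<open>The penalized subproblems\<close>

lemma spd_form_scaled:
  assumes "symmetric_positive_definite W" "0 < c"
  shows "spd_form (\<lambda>a. c *\<^sub>R (W *v a))"
proof (rule spd_form.intro)
  show "linear (\<lambda>a. c *\<^sub>R (W *v a))"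
    by (rule linearI) (simp_all add: matrix_vector_right_distrib matrix_vector_mult_scaleR
        scaleR_right_distrib)
  show "c *\<^sub>R (W *v a) \<bullet> b = a \<bullet> c *\<^sub>R (W *v b)" for a b
    using assms(1) transpose_inner[of a W b] by (simp add: symmetric_positive_definite_def)
  show "0 < a \<bullet> c *\<^sub>R (W *v a)" if "a \<noteq> 0" for a
    using assms that by (simp add: symmetric_positive_definite_def)
qed

lemma subproblem_objective_eq:
  assumes W: "symmetric_positive_definite W" and c: "0 < c"
    and A: "A = (\<lambda>a. c *\<^sub>R (W *v a))"
  shows "subproblem_objective f M W c p z x =
    f x + ereal (p \<bullet> (M *v x) + (spd_form.nrm A (M *v x - z))\<^sup>2 / 2)"
proof -
  interpret spd_form A unfolding A by (rule spd_form_scaled[OF W c])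
  have "0 \<le> a \<bullet> (W *v a)" for a
    using W by (cases "a = 0") (auto simp: symmetric_positive_definite_def less_imp_le)
  moreover have "(nrm a)\<^sup>2 = c * (a \<bullet> (W *v a))" for a
    unfolding nrm_sq form_def by (simp add: A)
  ultimately have "c / 2 * (weighted_norm W a)\<^sup>2 = (nrm a)\<^sup>2 / 2" for a
    by (simp add: weighted_norm_def)
  then show ?thesis by (simp add: subproblem_objective_def add.assoc)
qed

text \<open>Around the exact minimizer the objective grows at least like half the squared
  \<open>nrm\<close> of the change in \<open>M *v x\<close>. So approximate minimality controls the
  image under \<open>M\<close>, with error of order \<open>sqrt \<tau>\<close>.\<close>

lemma subproblem_optimality:
  fixes f :: "real ^ 'n \<Rightarrow> ereal" and M :: "real ^ 'n ^ 'm"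
  assumes f: "closed_proper_convex f" and W: "symmetric_positive_definite W" and c: "0 < c"
    and A: "A = (\<lambda>a. c *\<^sub>R (W *v a))"
    and y: "is_arg_min (subproblem_objective f M W c p z) (\<lambda>_. True) y"
  shows "- (transpose M *v (p + A (M *v y - z))) \<in> subdifferential f y"
    and "x \<in> approx_arg_min \<tau> UNIV (subproblem_objective f M W c p z) \<Longrightarrow>
      (spd_form.nrm A (M *v x - M *v y))\<^sup>2 \<le> 2 * \<tau>"
proof -
  interpret spd_form A unfolding A by (rule spd_form_scaled[OF W c])
  have ninf: "\<And>x. f x \<noteq> - \<infinity>" using f by (simp add: closed_proper_convex_def)
  define q where "q w = p \<bullet> (M *v w) + (nrm (M *v w - z))\<^sup>2 / 2" for w
  have obj: "subproblem_objective f M W c p z w = f w + ereal (q w)" for w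
    unfolding q_def by (rule subproblem_objective_eq[OF W c A])
  have opt: "f y + ereal (q y) \<le> f w + ereal (q w)" for w
    using y by (simp add: is_arg_min_def obj not_less)
  obtain x0 a0 where x0: "f x0 = ereal a0" using proper_point[OF f] .
  have "f y \<noteq> \<infinity>" using opt[of x0] by (auto simp: x0)
  with ninf[of y] obtain a where a: "f y = ereal a" by (cases "f y") auto
  define g where "g = transpose M *v (p + A (M *v y - z))"
  have gw: "g \<bullet> w = p \<bullet> (M *v w) + form (M *v y - z) (M *v w)" for w
    using transpose_inner[of w M "p + A (M *v y - z)"]
    by (simp add: g_def inner_commute[of _ w] inner_add_right form_commute[of "M *v y - z"])
      (simp add: form_def inner_commute)
  have q: "q (y + \<theta> *\<^sub>R w) = q y + \<theta> * (g \<bullet> w) + \<theta>\<^sup>2 * ((nrm (M *v w))\<^sup>2 / 2)" for w \<theta>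
  proof -
    have e: "M *v (y + \<theta> *\<^sub>R w) - z = (M *v y - z) + \<theta> *\<^sub>R (M *v w)"
      by (simp add: matrix_vector_right_distrib matrix_vector_mult_scaleR)
    have "(nrm (M *v (y + \<theta> *\<^sub>R w) - z))\<^sup>2 =
      form (M *v y - z) (M *v y - z) + 2 * \<theta> * form (M *v y - z) (M *v w)
        + \<theta>\<^sup>2 * form (M *v w) (M *v w)"
      unfolding nrm_sq e by (rule form_quadratic)
    then show ?thesis
      by (simp add: q_def gw nrm_sq matrix_vector_right_distrib matrix_vector_mult_scaleR
          inner_add_right algebra_simps)
  qed
  show sub: "- (transpose M *v (p + A (M *v y - z))) \<in> subdifferential f y"
    unfolding g_def[symmetric]
  proof (rule minimizer_subgradient[of f y a q, OF f a _ q])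
    fix w t assume "(w, t) \<in> ereal_epigraph f"
    then obtain b where b: "f w = ereal b" "b \<le> t" using epigraph_finite ninf by metis
    with opt[of w] a show "a + q y \<le> t + q w" by simp
  qed
  show "(nrm (M *v x - M *v y))\<^sup>2 \<le> 2 * \<tau>"
    if "x \<in> approx_arg_min \<tau> UNIV (subproblem_objective f M W c p z)"
  proof -
    have "f x + ereal (q x) \<le> (INF w. f w + ereal (q w)) + ereal \<tau>"
      using that by (simp add: approx_arg_min_def obj)
    also have "\<dots> \<le> f y + ereal (q y) + ereal \<tau>" by (intro add_right_mono INF_lower) simp
    finally have le: "f x + ereal (q x) \<le> ereal (a + q y + \<tau>)" by (simp add: a)
    then have "f x \<noteq> \<infinity>" by auto
    with ninf[of x] obtain b where b: "f x = ereal b" by (cases "f x") auto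
    have "a + (- g) \<bullet> (x - y) \<le> b"
      using sub epigraph_of_finite[of f, OF b]
      unfolding subdifferential_iff[of f, OF ninf a] g_def by blast
    \<comment> \<open>The expansion at \<open>\<theta> = 1\<close> is exact, and its linear term
      cancels against the subgradient inequality.\<close>
    moreover have "q x = q y + g \<bullet> (x - y) + (nrm (M *v x - M *v y))\<^sup>2 / 2"
      using q[of 1 "x - y"] by (simp add: matrix_vector_mult_diff_distrib)
    ultimately show ?thesis using le b by simp
  qed
qed

section \<open>Weak duality and limit points\<close>

lemma conjugate_comp_lower_bound:
  fixes f :: "real ^ 'n \<Rightarrow> ereal" and M :: "real ^ 'n ^ 'm"
  assumes "f x = ereal a"
  shows "ereal (- a - (M *v x) \<bullet> q) \<le> conjugate_comp f M q"
  unfolding conjugate_comp_def convex_conjugate_def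
  by (rule SUP_upper2[of x]) (auto simp: assms transpose_inner)

lemma weak_duality:
  fixes f :: "real ^ 'n \<Rightarrow> ereal" and M :: "real ^ 'n ^ 'm"
  assumes f: "closed_proper_convex f" and "M *v w \<in> V" "q \<in> V\<^sup>\<bottom>"
    and q: "conjugate_comp f M q = ereal \<beta>"
  shows "ereal (- \<beta>) \<le> f w"
proof (cases "f w")
  case (real b)
  have "(M *v w) \<bullet> q = 0" using assms by (simp add: orthogonal_comp_def orthogonal_def)
  with conjugate_comp_lower_bound[of f w b M q, OF real] q real show ?thesis by simp
qed (use f in \<open>auto simp: closed_proper_convex_def\<close>)

lemma sqrt_summable_tendsto_0:
  assumes "\<And>k. 0 \<le> \<tau> k" "summable (\<lambda>k. sqrt (\<tau> k))"
  shows "\<tau> \<longlonglongrightarrow> 0"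
proof -
  have "(\<lambda>k. (sqrt (\<tau> k))\<^sup>2) \<longlonglongrightarrow> 0\<^sup>2"
    by (intro tendsto_power summable_LIMSEQ_zero assms(2))
  then show ?thesis using assms(1) by simp
qed

lemma subsequence_limit_le:
  fixes f :: "'a::euclidean_space \<Rightarrow> ereal"
  assumes f: "closed_proper_convex f"
    and T: "\<And>k. (x (Suc k), T k) \<in> ereal_epigraph f" "T \<longlonglongrightarrow> b"
    and r: "strict_mono r" "(x \<circ> r) \<longlonglongrightarrow> l"
  shows "f l \<le> ereal b"
proof -
  \<comment> \<open>The height \<open>T k\<close> belongs to \<open>x (Suc k)\<close>. Dropping the
    first term of the subsequence makes the index positive, so the predecessor is genuine.\<close>
  define r' where "r' n = r (Suc n) - 1" for n
  have Suc_r': "Suc (r' n) = r (Suc n)" for n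
    using strict_mono_less[OF r(1), of 0 "Suc n"] by (simp add: r'_def)
  have "strict_mono r'"
    unfolding strict_mono_Suc_iff
  proof
    fix n
    have "Suc (r' n) < Suc (r' (Suc n))"
      unfolding Suc_r' using r(1) by (simp add: strict_mono_less)
    then show "r' n < r' (Suc n)" by simp
  qed
  then have T': "(\<lambda>n. T (r' n)) \<longlonglongrightarrow> b"
    using LIMSEQ_subseq_LIMSEQ[OF T(2)] by (simp add: o_def)
  have "(\<lambda>n. x (r (Suc n))) \<longlonglongrightarrow> l" using LIMSEQ_Suc[OF r(2)] by (simp add: o_def)
  then have "(\<lambda>n. (x (Suc (r' n)), T (r' n))) \<longlonglongrightarrow> (l, b)"
    unfolding Suc_r' using T' by (rule tendsto_Pair)
  then have "(l, b) \<in> ereal_epigraph f"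
    by (rule closed_sequentially[rotated 2]) (use f T(1) in \<open>auto simp: closed_proper_convex_def\<close>)
  then show ?thesis by (simp add: ereal_epigraph_def)
qed

theorem proposition18:
  fixes f :: "real ^ 'n \<Rightarrow> ereal"
    and M :: "real ^ 'n ^ 'm"
    and V :: "(real ^ 'm) set"
    and W :: "real ^ 'm ^ 'm"
    and \<tau> \<nu> :: "nat \<Rightarrow> real"
    and c :: real
    and x :: "nat \<Rightarrow> real ^ 'n"
    and z v p :: "nat \<Rightarrow> real ^ 'm"
  assumes "closed_proper_convex f"
    and "subspace V"
    and "symmetric_positive_definite W"
    and "\<And>k. \<tau> k \<ge> 0"
    and "summable (\<lambda>k. sqrt (\<tau> k))"
    and "(INF k. ereal (\<nu> k)) > 0"
    and "(SUP k. ereal (\<nu> k)) < 2"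
    and "c > 0"
    and "\<And>k. z k \<in> V"
    and "\<And>k. v (Suc k) \<in> V"
    and "\<And>k. p k \<in> V\<^sup>\<bottom>"
    and "\<And>k. x (Suc k) \<in> approx_arg_min (\<tau> k) UNIV (subproblem_objective f M W c (p k) (z k))"
    and "\<And>k. v (Suc k) = weighted_proj W V (M *v x (Suc k))"
    and "\<And>k. z (Suc k) = \<nu> k *\<^sub>R v (Suc k) + (1 - \<nu> k) *\<^sub>R z k"
    and "\<And>k. p (Suc k) = p k + (\<nu> k * c) *\<^sub>R (W *v (M *v x (Suc k) - v (Suc k)))"
    and "\<And>k. \<exists>y. is_arg_min (subproblem_objective f M W c (p k) (z k)) (\<lambda>_. True) y"
  shows
    "(strong_duality f M V \<longrightarrow>
       (\<exists>ps zs.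
          dual_solution f M V ps \<and> p \<longlonglongrightarrow> ps \<and>
          zs \<in> V \<and> z \<longlonglongrightarrow> zs \<and> v \<longlonglongrightarrow> zs \<and> (\<lambda>k. M *v x k) \<longlonglongrightarrow> zs \<and>
          - zs \<in> subdifferential (conjugate_comp f M) ps \<and>
          (rel_interior (\<Union>y. subdifferential f y) \<inter> range ((*v) (transpose M)) \<noteq> {} \<longrightarrow>
             (\<exists>xs. primal_solution f M V xs \<and> zs = M *v xs) \<and>
             (\<forall>l r. strict_mono r \<and> (x \<circ> r) \<longlonglongrightarrow> l \<longrightarrow> primal_solution f M V l)))) \<and>
     ((\<nexists>q. dual_solution f M V q) \<and> (\<exists>pbar. \<bar>dual_objective f M V pbar\<bar> \<noteq> \<infinity>) \<longrightarrow>
       \<not> bounded (range p) \<or> \<not> bounded (range z))"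
proof -
  note f = assms(1) and V = assms(2) and W = assms(3) and \<tau> = assms(4,5) and c = assms(8)
    and zV = assms(9) and pV = assms(11) and xapprox = assms(12)
    and zstep = assms(14) and pstep = assms(15)
  have ninf: "\<And>x. f x \<noteq> - \<infinity>" using f by (simp add: closed_proper_convex_def)
  define h where "h = conjugate_comp f M"
  define A where "A = (\<lambda>a. c *\<^sub>R (W *v a))"
  interpret spd_form A unfolding A_def by (rule spd_form_scaled[OF W c])
  define \<Gamma> where "\<Gamma> = {(q, y). - y \<in> subdifferential h q}"
  from assms(16) obtain xb where
    xb: "\<And>k. is_arg_min (subproblem_objective f M W c (p k) (z k)) (\<lambda>_. True) (xb k)" by metis
  define u where "u k = inv A (p k)" for k
  have Au: "A (u k) = p k" for k
    by (simp add: u_def A_inv)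
  \<comment> \<open>The deviation of the inexact from the exact subproblem solution, seen through
    \<open>M\<close>; the iterate carries index \<open>Suc k\<close>, the exact minimizer index
    \<open>k\<close>.\<close>
  define m where "m k = M *v x (Suc k) - M *v xb k" for k
  define d where "d k = M *v xb k - z k" for k
  define e where "e k = \<nu> k *\<^sub>R m k" for k
  note sub = subproblem_optimality[OF f W c A_def xb]

  obtain l where l: "0 < l" "\<And>k. l \<le> \<nu> k"
  proof -
    obtain l where "0 < ereal l" and l: "ereal l < (INF k. ereal (\<nu> k))"
      using ereal_dense2[OF assms(6)] by auto
    moreover have "l \<le> \<nu> k" for k
      using order.strict_trans2[OF l INF_lower[OF UNIV_I, of "\<lambda>k. ereal (\<nu> k)" k]] by simp
    ultimately show ?thesis using that by simp
  qed
  obtain \<omega> where \<omega>: "0 < \<omega>" "\<And>k. \<nu> k \<le> 2 - \<omega>"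
  proof -
    obtain b where b: "(SUP k. ereal (\<nu> k)) < ereal b" and "ereal b < ereal 2"
      using ereal_dense2[OF assms(7)[unfolded numeral_eq_ereal]] by auto
    moreover have "\<nu> k \<le> b" for k
      using order.strict_trans1[OF SUP_upper[OF UNIV_I, of "\<lambda>k. ereal (\<nu> k)" k] b] by simp
    ultimately show ?thesis using that[of "2 - b"] by simp
  qed
  have nm: "nrm (m k) \<le> sqrt 2 * sqrt (\<tau> k)" for k
  proof -
    have "(nrm (m k))\<^sup>2 \<le> 2 * \<tau> k" unfolding m_def by (rule sub(2)[OF xapprox])
    then have "nrm (m k) \<le> sqrt (2 * \<tau> k)" by (rule real_le_rsqrt)
    then show ?thesis by (simp add: real_sqrt_mult)
  qed
  have e_summable: "summable (\<lambda>k. nrm (e k))"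
  proof (rule summable_comparison_test')
    show "summable (\<lambda>k. 2 * (sqrt 2 * sqrt (\<tau> k)))" by (intro summable_mult \<tau>(2))
    show "norm (nrm (e k)) \<le> 2 * (sqrt 2 * sqrt (\<tau> k))" if "0 \<le> k" for k
    proof -
      have "\<bar>\<nu> k\<bar> \<le> 2" using l(1) l(2)[of k] \<omega>(1) \<omega>(2)[of k] by simp
      then have "\<bar>\<nu> k\<bar> * nrm (m k) \<le> 2 * (sqrt 2 * sqrt (\<tau> k))"
        using nm[of k] nrm_nonneg by (intro mult_mono) auto
      then show ?thesis by (simp add: e_def nrm_scaleR nrm_nonneg)
    qed
  qed

  \<comment> \<open>Finiteness of \<open>h\<close> at one point makes it proper; each half of the
    theorem supplies such a point.\<close>
  have splitting: "relaxed_splitting A V \<Gamma> z u d e \<nu> l \<omega>" and h: "closed_proper_convex h"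
    if fin: "h q0 \<noteq> \<infinity>" for q0
  proof -
    show h: "closed_proper_convex h"
      unfolding h_def by (rule closed_proper_convex_conjugate_comp[OF f fin[unfolded h_def]])
    have "spd_form A" by (rule spd_form_axioms)
    moreover have "relaxed_splitting_axioms A V \<Gamma> z u d e \<nu> l \<omega>"
    proof
      show "(q - q') \<bullet> (y - y') \<le> 0" if "(q, y) \<in> \<Gamma>" "(q', y') \<in> \<Gamma>" for q y q' y'
        using subdifferential_monotone[OF h, of "- y" q "- y'" q'] that
        by (simp add: \<Gamma>_def inner_diff_left inner_diff_right inner_commute)
      have eq: "\<Gamma> = (\<lambda>p. (fst p, - snd p)) -` {(q, s). s \<in> subdifferential h q}"
        by (auto simp: \<Gamma>_def)
      show "closed \<Gamma>"
        unfolding eq by (rule closed_vimage[OF closed_subdifferential_graph[OF h]]) (intro continuous_intros)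
      show "form w (u k) = 0" if "w \<in> V" for k w
        using pV[of k] that by (simp add: form_def Au orthogonal_comp_def orthogonal_def)
      \<comment> \<open>Optimality of the exact minimizer \<open>xb k\<close>, pushed through the
        easy inclusion of the chain rule; the multiplier there is
        \<open>p k + A (d k)\<close>.\<close>
      show "(A (u k + d k), z k + d k) \<in> \<Gamma>" for k
        using subdifferential_conjugate_comp[OF f sub(1), of k]
        by (simp add: \<Gamma>_def linear_add[OF lin] Au d_def h_def)
      show "z (Suc k) + u (Suc k) = z k + u k + \<nu> k *\<^sub>R d k + e k" for k
      proof -
        have "A (u (Suc k)) = A (u k + \<nu> k *\<^sub>R (M *v x (Suc k) - v (Suc k)))"
          by (simp add: Au pstep linear_add[OF lin] linear_scale[OF lin])
            (simp add: A_def)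
        then have "u (Suc k) = u k + \<nu> k *\<^sub>R (M *v x (Suc k) - v (Suc k))"
          using bij_A by (simp add: bij_def inj_eq)
        \<comment> \<open>In the sum of the two updates \<open>v (Suc k)\<close> cancels, and
          \<open>M *v x (Suc k) - z k\<close> is \<open>d k + m k\<close>.\<close>
        then show ?thesis by (simp add: zstep e_def d_def m_def algebra_simps)
      qed
    qed (rule V zV l \<omega> e_summable)+
    ultimately show "relaxed_splitting A V \<Gamma> z u d e \<nu> l \<omega>" by (rule relaxed_splitting.intro)
  qed

  \<comment> \<open>Differences of points in \<open>V\<^sup>\<bottom>\<close> are orthogonal to the
    subgradient \<open>- zs\<close>, so the subgradient inequality becomes minimality over
    \<open>V\<^sup>\<bottom>\<close>.\<close>
  have dual: "dual_solution f M V (A u') \<and> A u' \<in> V\<^sup>\<bottom>"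
    if "zs \<in> V" "\<And>w. w \<in> V \<Longrightarrow> form w u' = 0" "(A u', zs) \<in> \<Gamma>" for zs u'
  proof -
    have perp: "A u' \<in> V\<^sup>\<bottom>" using that(2) by (simp add: orthogonal_comp_def orthogonal_def form_def)
    have "h (A u') \<le> h q" if "q \<in> V\<^sup>\<bottom>" for q
    proof -
      have "zs \<bullet> (q - A u') = 0"
        using perp \<open>q \<in> V\<^sup>\<bottom>\<close> \<open>zs \<in> V\<close>
        by (simp add: orthogonal_comp_def orthogonal_def inner_diff_right)
      moreover have "h (A u') + ereal ((- zs) \<bullet> (q - A u')) \<le> h q"
        using \<open>(A u', zs) \<in> \<Gamma>\<close> by (simp only: \<Gamma>_def subdifferential_def mem_Collect_eq case_prod_conv)
      ultimately show ?thesis by (simp add: zero_ereal_def[symmetric])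
    qed
    then show ?thesis using perp by (auto simp: dual_solution_def is_arg_min_def h_def not_less)
  qed

  have part1: "\<exists>ps zs.
          dual_solution f M V ps \<and> p \<longlonglongrightarrow> ps \<and>
          zs \<in> V \<and> z \<longlonglongrightarrow> zs \<and> v \<longlonglongrightarrow> zs \<and> (\<lambda>k. M *v x k) \<longlonglongrightarrow> zs \<and>
          - zs \<in> subdifferential (conjugate_comp f M) ps \<and>
          (rel_interior (\<Union>y. subdifferential f y) \<inter> range ((*v) (transpose M)) \<noteq> {} \<longrightarrow>
             (\<exists>xs. primal_solution f M V xs \<and> zs = M *v xs) \<and>
             (\<forall>l r. strict_mono r \<and> (x \<circ> r) \<longlonglongrightarrow> l \<longrightarrow> primal_solution f M V l))"
    if sd: "strong_duality f M V"
  proof -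
    obtain x0 p0 where x0: "M *v x0 \<in> V" "p0 \<in> V\<^sup>\<bottom>" "f x0 + h p0 = 0"
      using sd by (auto simp: strong_duality_def h_def)
    then obtain a where a: "f x0 = ereal a" "h p0 = ereal (- a)"
      by (cases "f x0"; cases "h p0") (auto simp: zero_ereal_def)
    then have fin: "h p0 \<noteq> \<infinity>" by simp
    interpret S: relaxed_splitting A V \<Gamma> z u d e \<nu> l \<omega> by (rule splitting[OF fin])
    define u0 where "u0 = inv A p0"
    have Au0: "A u0 = p0"
      by (simp add: u0_def A_inv)
    have "u0 \<in> S.U"
      using x0(2) by (simp add: S.U_def form_def Au0 orthogonal_comp_def orthogonal_def)
    \<comment> \<open>The affine lower bound coming from \<open>x0\<close> is attained at
      \<open>p0\<close>, so a strong duality pair is the solution that \<open>S.converges\<close>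
      asks for.\<close>
    moreover have "(A u0, M *v x0) \<in> \<Gamma>"
    proof -
      have "(M *v x0) \<bullet> p0 = 0" using x0 by (simp add: orthogonal_comp_def orthogonal_def)
      then have "h p0 + ereal (- (M *v x0) \<bullet> (q - p0)) \<le> h q" for q
        using conjugate_comp_lower_bound[of f x0 a M q, OF a(1)] a(2)
        by (simp add: inner_diff_right h_def)
      then show ?thesis by (simp add: \<Gamma>_def Au0 subdifferential_def)
    qed
    ultimately obtain zs us where s: "zs \<in> V" "us \<in> S.U" "(A us, zs) \<in> \<Gamma>"
      and zlim: "z \<longlonglongrightarrow> zs" and ulim: "u \<longlonglongrightarrow> us" and dlim: "d \<longlonglongrightarrow> 0"
      using S.converges x0(1) by blast
    define ps where "ps = A us"
    have psol: "dual_solution f M V ps" and psV: "ps \<in> V\<^sup>\<bottom>"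
      using dual[OF s(1) _ s(3)] s(2) by (auto simp: ps_def S.U_def)
    have plim: "p \<longlonglongrightarrow> ps"
      using bounded_linear.tendsto[OF linear_conv_bounded_linear[THEN iffD1, OF lin] ulim]
      by (simp add: Au ps_def)
    have subd: "- zs \<in> subdifferential (conjugate_comp f M) ps"
      using s(3) by (simp add: \<Gamma>_def h_def ps_def)
    have mlim: "m \<longlonglongrightarrow> 0"
    proof (rule nrm_tendsto_0D, rule tendsto_sandwich[OF _ _ tendsto_const])
      show "(\<lambda>k. sqrt 2 * sqrt (\<tau> k)) \<longlonglongrightarrow> 0"
        using tendsto_mult_right_zero[OF summable_LIMSEQ_zero[OF \<tau>(2)]] .
    qed (use nm nrm_nonneg in auto)
    \<comment> \<open>The sum telescopes to \<open>M *v x (Suc k)\<close>.\<close>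
    have "(\<lambda>k. z k + d k + m k) \<longlonglongrightarrow> zs + 0 + 0" by (intro tendsto_add zlim dlim mlim)
    then have "(\<lambda>k. M *v x (Suc k)) \<longlonglongrightarrow> zs" by (simp add: d_def m_def)
    then have Mlim: "(\<lambda>k. M *v x k) \<longlonglongrightarrow> zs" by (rule LIMSEQ_imp_Suc)
    have vlim: "v \<longlonglongrightarrow> zs"
    proof -
      \<comment> \<open>The update of \<open>z\<close> solved for \<open>v\<close>; the division is
        harmless as \<open>\<nu> k \<ge> l > 0\<close>.\<close>
      have v: "v (Suc k) = z k + (1 / \<nu> k) *\<^sub>R (z (Suc k) - z k)" for k
      proof -
        have "\<nu> k \<noteq> 0" using l(1) l(2)[of k] by auto
        moreover have "z (Suc k) - z k = \<nu> k *\<^sub>R (v (Suc k) - z k)"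
          by (simp add: zstep algebra_simps)
        ultimately show ?thesis by simp
      qed
      have zd: "(\<lambda>k. z (Suc k) - z k) \<longlonglongrightarrow> 0"
        using tendsto_diff[OF LIMSEQ_Suc[OF zlim] zlim] by simp
      have "(\<lambda>k. (1 / \<nu> k) *\<^sub>R (z (Suc k) - z k)) \<longlonglongrightarrow> 0"
      proof (rule Lim_null_comparison)
        show "(\<lambda>k. 1 / l * norm (z (Suc k) - z k)) \<longlonglongrightarrow> 0"
          by (rule tendsto_mult_right_zero[OF tendsto_norm_zero[OF zd]])
        have "norm ((1 / \<nu> k) *\<^sub>R (z (Suc k) - z k)) \<le> 1 / l * norm (z (Suc k) - z k)" for k
        proof -
          have "\<bar>1 / \<nu> k\<bar> \<le> 1 / l" using l(1) l(2)[of k] by (simp add: frac_le)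
          then show ?thesis unfolding norm_scaleR by (rule mult_right_mono) simp
        qed
        then show "\<forall>\<^sub>F k in sequentially.
            norm ((1 / \<nu> k) *\<^sub>R (z (Suc k) - z k)) \<le> 1 / l * norm (z (Suc k) - z k)" by simp
      qed
      then have "(\<lambda>k. v (Suc k)) \<longlonglongrightarrow> zs" using tendsto_add[OF zlim] by (fastforce simp: v)
      then show ?thesis by (rule LIMSEQ_imp_Suc)
    qed
    have primal: "(\<exists>xs. primal_solution f M V xs \<and> zs = M *v xs) \<and>
             (\<forall>l r. strict_mono r \<and> (x \<circ> r) \<longlonglongrightarrow> l \<longrightarrow> primal_solution f M V l)"
      if ri: "rel_interior (\<Union>y. subdifferential f y) \<inter> range ((*v) (transpose M)) \<noteq> {}"
    proof -
      obtain \<beta> where \<beta>: "conjugate_comp f M ps = ereal \<beta>"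
        using subdifferential_finite[OF h[OF fin], of "- zs" ps] subd by (auto simp: h_def)
      obtain xs where xs: "M *v xs = zs" "f xs = ereal (- (zs \<bullet> ps) - \<beta>)"
        using conjugate_comp_chain_rule[OF f ri subd \<beta>] .
      have "zs \<bullet> ps = 0" using s(1) psV by (simp add: orthogonal_comp_def orthogonal_def)
      with xs have fxs: "f xs = ereal (- \<beta>)" by simp
      \<comment> \<open>By weak duality the dual value gives \<open>- \<beta>\<close> as a lower
        bound for the primal problem, so reaching it means optimality.\<close>
      have opt: "primal_solution f M V w" if "M *v w \<in> V" "f w \<le> ereal (- \<beta>)" for w
      proof -
        have "f w \<le> f w'" if "M *v w' \<in> V" for w'
          using \<open>f w \<le> _\<close> weak_duality[OF f that psV \<beta>] by (rule order_trans)
        then show ?thesis using \<open>M *v w \<in> V\<close> by (auto simp: primal_solution_def is_arg_min_def not_less)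
      qed
      have "primal_solution f M V l'" if r: "strict_mono r" "(x \<circ> r) \<longlonglongrightarrow> l'" for l' r
      proof (rule opt)
        have "(\<lambda>n. M *v x (r n)) \<longlonglongrightarrow> M *v l'"
          using bounded_linear.tendsto[OF matrix_vector_mul_bounded_linear r(2)] by (simp add: o_def)
        moreover have "(\<lambda>n. M *v x (r n)) \<longlonglongrightarrow> zs"
          using LIMSEQ_subseq_LIMSEQ[OF Mlim r(1)] by (simp add: o_def)
        ultimately show "M *v l' \<in> V" using LIMSEQ_unique s(1) by metis
        define q where "q k w = p k \<bullet> (M *v w) + (nrm (M *v w - z k))\<^sup>2 / 2" for k w
        \<comment> \<open>The upper bound for \<open>f (x (Suc k))\<close> obtained by comparing
          approximate minimality with \<open>xs\<close>. The two \<open>q\<close> terms have the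
          same limit \<open>ps \<bullet> zs\<close>, so \<open>T\<close> tends to
          \<open>- \<beta>\<close>.\<close>
        define T where "T k = - \<beta> + q k xs + \<tau> k - q k (x (Suc k))" for k
        have "(x (Suc k), T k) \<in> ereal_epigraph f" for k
        proof -
          note obj = subproblem_objective_eq[OF W c A_def, of f M "p k" "z k", folded q_def]
          have "f (x (Suc k)) + ereal (q k (x (Suc k)))
              \<le> (INF w. f w + ereal (q k w)) + ereal (\<tau> k)"
            using xapprox[of k] by (simp add: approx_arg_min_def obj)
          also have "\<dots> \<le> f xs + ereal (q k xs) + ereal (\<tau> k)" by (intro add_right_mono INF_lower) simp
          finally show ?thesis
            using ninf[of "x (Suc k)"]
            by (cases "f (x (Suc k))") (auto simp: fxs ereal_epigraph_def T_def)
        qed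
        moreover have "T \<longlonglongrightarrow> - \<beta>"
        proof -
          have MSlim: "(\<lambda>k. M *v x (Suc k)) \<longlonglongrightarrow> zs" by (rule LIMSEQ_Suc[OF Mlim])
          have "(\<lambda>k. zs - z k) \<longlonglongrightarrow> 0" "(\<lambda>k. M *v x (Suc k) - z k) \<longlonglongrightarrow> 0"
            using tendsto_diff[OF tendsto_const zlim, of zs] tendsto_diff[OF MSlim zlim] by simp_all
          from this[THEN tendsto_nrm]
          have n: "(\<lambda>k. nrm (zs - z k)) \<longlonglongrightarrow> 0" "(\<lambda>k. nrm (M *v x (Suc k) - z k)) \<longlonglongrightarrow> 0"
            by simp_all
          have "T \<longlonglongrightarrow> - \<beta> + (ps \<bullet> zs + 0\<^sup>2 / 2) + 0 - (ps \<bullet> zs + 0\<^sup>2 / 2)"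
            unfolding T_def[abs_def] q_def xs(1)
            by (intro tendsto_add tendsto_diff tendsto_inner tendsto_divide tendsto_power tendsto_const
                plim n MSlim sqrt_summable_tendsto_0 \<tau>) simp_all
          then show ?thesis by simp
        qed
        ultimately show "f l' \<le> ereal (- \<beta>)" by (rule subsequence_limit_le[OF f _ _ r])
      qed
      moreover have "primal_solution f M V xs" by (rule opt) (use xs(1) s(1) fxs in auto)
      ultimately show ?thesis using xs(1) by blast
    qed
    show ?thesis
      using psol plim s(1) zlim vlim Mlim subd primal by blast
  qed

  have part2: False
    if nosol: "\<nexists>q. dual_solution f M V q" and fin: "\<bar>dual_objective f M V pbar\<bar> \<noteq> \<infinity>"
      and bp: "bounded (range p)" and bz: "bounded (range z)" for pbar
  proof -
    have hfin: "h pbar \<noteq> \<infinity>" using fin by (auto simp: dual_objective_def h_def)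
    interpret S: relaxed_splitting A V \<Gamma> z u d e \<nu> l \<omega> by (rule splitting[OF hfin])
    have "bounded (range u)"
      using bounded_linear_image[OF bp linear_conv_bounded_linear[THEN iffD1, OF linear_inv]]
      by (simp add: u_def[abs_def] image_image)
    then have "bounded (range (\<lambda>k. z k + u k))" by (rule bounded_plus_comp[OF bz])
    then obtain C where C: "\<And>k. norm (z k + u k) \<le> C" by (auto simp: bounded_iff)
    have "compact (nrm ` cball 0 C)" by (intro compact_continuous_image continuous_on_nrm) auto
    then obtain R where R: "\<And>a. norm a \<le> C \<Longrightarrow> nrm a \<le> R"
      using compact_imp_bounded bounded_iff by (metis abs_le_D1 imageI mem_cball_0 real_norm_def)
    obtain x0 a0 where x0: "f x0 = ereal a0" using proper_point[OF f] .
    \<comment> \<open>Fenchel-Young at a point of the domain of \<open>f\<close> provides the affine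
      minorant needed by \<open>regularized_solution\<close>.\<close>
    have minorant: "(- (M *v x0)) \<bullet> w - a0 \<le> t" if "(w, t) \<in> ereal_epigraph h" for w t
    proof -
      have "h w \<le> ereal t" using that by (simp add: ereal_epigraph_def)
      with conjugate_comp_lower_bound[of f x0 a0 M w, OF x0] have "ereal (- a0 - (M *v x0) \<bullet> w) \<le> ereal t"
        unfolding h_def by (rule order_trans)
      then show ?thesis by simp
    qed
    have "\<exists>z'\<in>V. \<exists>u'\<in>S.U. (A u', z') \<in> \<Gamma>"
    proof (rule S.bounded_imp_solution)
      show "nrm (z k + u k) \<le> R" for k by (rule R[OF C])
      show "\<exists>z'\<in>V. \<exists>u'\<in>S.U. (A (u' + \<epsilon> *\<^sub>R (z' + u')), z' + \<epsilon> *\<^sub>R (z' + u')) \<in> \<Gamma>"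
        if "0 < \<epsilon>" for \<epsilon>
        using regularized_solution[OF h[OF hfin] V minorant that] by (auto simp: \<Gamma>_def S.U_def)
    qed
    then obtain zs us where "zs \<in> V" "us \<in> S.U" "(A us, zs) \<in> \<Gamma>" by blast
    then have "dual_solution f M V (A us)" using dual[of zs us] by (simp add: S.U_def)
    with nosol show False by blast
  qed
  show ?thesis
  proof (intro conjI impI)
    show "\<not> bounded (range p) \<or> \<not> bounded (range z)"
      if "(\<nexists>q. dual_solution f M V q) \<and> (\<exists>pbar. \<bar>dual_objective f M V pbar\<bar> \<noteq> \<infinity>)"
    proof (rule ccontr)
      from that obtain pbar where "\<bar>dual_objective f M V pbar\<bar> \<noteq> \<infinity>" by (elim conjE exE)
      moreover assume "\<not> ?thesis"
      ultimately show False using that part2[of pbar] by (elim conjE) simp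
    qed
  qed (rule part1)
qed

end
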